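(* Let $d\ge1$ and let $\delta\in\mathbb{R}$ not be an integer. There is a constant $C=C(d,\delta)$ such that for every real smooth function $f$ on $\mathbb{R}^d$ supported in an annulus $\{a\le|x|\le b\}$, $0<a<b$, $$\int_{\mathbb{R}^d}|f|^2r^{\delta}\,d\mathrm{Vol}\le C\int_{\mathbb{R}^d}|\Delta f|^2r^{\delta+4}\,d\mathrm{Vol},\qquad r=|x|.$$ *)

theory Defs
  imports "HOL-Analysis.Analysis"
begin

definition partial_deriv :: "'n::finite \<Rightarrow> (real^'n \<Rightarrow> real) \<Rightarrow> real^'n \<Rightarrow> real" where
  "partial_deriv i f = (\<lambda>x. deriv (\<lambda>t. f (x + t *\<^sub>R axis i 1)) 0)"

fun iter_partial :: "'n::finite list \<Rightarrow> (real^'n \<Rightarrow> real) \<Rightarrow> real^'n \<Rightarrow> real" where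
  "iter_partial [] f = f"
| "iter_partial (i # is) f = partial_deriv i (iter_partial is f)"

definition smooth_fun :: "(real^'n::finite \<Rightarrow> real) \<Rightarrow> bool" where
  "smooth_fun f \<longleftrightarrow>
     (\<forall>is. continuous_on UNIV (iter_partial is f) \<and>
           (\<forall>i x. (\<lambda>t. iter_partial is f (x + t *\<^sub>R axis i 1)) differentiable (at 0)))"

definition laplacian :: "(real^'n::finite \<Rightarrow> real) \<Rightarrow> real^'n \<Rightarrow> real" where
  "laplacian f = (\<lambda>x. \<Sum>i\<in>UNIV. partial_deriv i (partial_deriv i f) x)"

end

theory Submission
  imports Defs
begin

text \<open>
  Let \<open>E(z) = z / |z|\<^sup>d\<close>, a multiple of the gradient of the Newtonian potential. A regularisation
  argument gives \<open>c \<nabla>f(x) = \<integral> E(x - y) \<Delta>f(y) dy\<close> with a constant \<open>c > 0\<close>, for every \<open>d \<ge> 1\<close>.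
  Since \<open>\<nabla>f(s x)\<close> vanishes for small \<open>s\<close>, all Taylor coefficients in \<open>s\<close> of \<open>E(s x - y)\<close> integrate to
  zero against \<open>\<Delta>f\<close>; since \<open>\<nabla>f(x / s)\<close> vanishes for small \<open>s\<close>, so do those of \<open>E(x - s y)\<close>.
  Subtracting the right number of these terms from the kernel makes it bounded between the weighted
  spaces by Schur's test with power weights: with \<open>\<sigma> = -(\<delta> + d)/2\<close>, one subtracts \<open>\<lfloor>\<sigma>\<rfloor>\<close> terms of the first
  kind if \<open>\<sigma> > 1\<close>, \<open>\<lfloor>3 - d - \<sigma>\<rfloor>\<close> terms of the second kind if \<open>\<sigma> < 2 - d\<close>, and none otherwise; \<open>\<sigma>\<close> must
  not be an integer. This bounds \<open>\<nabla>f\<close> by \<open>\<Delta>f\<close>, and Hardy's inequality bounds \<open>f\<close> by \<open>\<nabla>f\<close>.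
\<close>

section \<open>Powers of the norm and integration by parts\<close>

text \<open>Working with \<open>E\<close> instead of the Newtonian potential treats all dimensions
  alike: \<open>E\<close> is homogeneous of degree 1 - d, with no logarithm for d = 2. The number
  \<sigma> is the critical degree: r^\<sigma> fails to be square integrable against r^\<delta> only
  logarithmically, both at 0 and at infinity. If \<sigma> were the degree of a homogeneous harmonic
  function on the punctured space, cutting that function off on longer and longer annuli would make
  the left side grow without bound while the right side stays bounded; such degrees are integers. In
  the proof the obstruction appears as a window. After N terms of the first kind are subtracted, the
  kernel is bounded by |x|^N |y|^(1-d-N) where |x| is much smaller than |y|, and by |x|^(N-1)
  |y|^(2-d-N) in the opposite regime; the Schur conditions on these two exponents read \<sigma> - 1
  < N < \<sigma>. This open interval of length one contains an integer precisely when \<sigma> is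
  not an integer. The second kind is the same computation with x and y exchanged.\<close>

lemma nn_integral_lborel_affine:
  fixes t :: "'a::euclidean_space" and c :: real
  assumes [measurable]: "f \<in> borel_measurable borel" and c: "c \<noteq> 0"
  shows "(\<integral>\<^sup>+x. f x \<partial>lborel) = ennreal (\<bar>c\<bar> ^ DIM('a)) * (\<integral>\<^sup>+x. f (t + c *\<^sub>R x) \<partial>lborel)"
  by (subst lborel_affine[OF c, of t])
     (simp add: nn_integral_density nn_integral_distr nn_integral_cmult)

lemma integral_lborel_affine:
  fixes t :: "'a::euclidean_space" and c :: real and f :: "'a \<Rightarrow> real"
  assumes [measurable]: "f \<in> borel_measurable borel" and c: "c \<noteq> 0"
  shows "(LINT x|lborel. f x) = \<bar>c\<bar> ^ DIM('a) * (LINT x|lborel. f (t + c *\<^sub>R x))"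
  by (subst lborel_affine[OF c, of t])
     (simp add: integral_density integral_distr)

text \<open>Dyadic shells replace polar coordinates: on the shell of radius \<open>\<rho> j\<close>
  the integrand is comparable to \<open>\<rho> j powr (-s)\<close>, and the enclosing ball has
  volume of order \<open>\<rho> j\<close> to the power d. Overlaps only increase the bound, and the
  origin is harmless because \<open>0 powr (-s) = 0\<close>.\<close>

lemma nn_integral_powr_norm_finite:
  fixes S :: "'a::euclidean_space set" and \<rho> :: "nat \<Rightarrow> real" and s :: real
  assumes S[measurable]: "S \<in> sets borel"
    and pos: "\<And>j. \<rho> j > 0"
    and cover: "\<And>z. z \<in> S \<Longrightarrow> z \<noteq> 0 \<Longrightarrow> \<exists>j. \<rho> j \<le> norm z \<and> norm z \<le> 2 * \<rho> j"
    and summ: "summable (\<lambda>j. \<rho> j powr (real DIM('a) - s))"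
  shows "(\<integral>\<^sup>+z. indicator S z * ennreal (norm z powr (-s)) \<partial>lborel) < \<infinity>"
proof -
  \<comment> \<open>The ratio of \<open>norm z\<close> to \<open>\<rho> j\<close> lies in [1, 2];
    the absolute value covers both signs of \<open>s\<close>.\<close>
  define C where "C = 2 powr \<bar>s\<bar>"
  define g where "g j z = ennreal (C * \<rho> j powr (-s)) * indicator (cball (0::'a) (2 * \<rho> j)) z" for j z
  have [measurable]: "g j \<in> borel_measurable borel" for j
    unfolding g_def[abs_def] by (intro borel_measurable_times_ennreal borel_measurable_const borel_measurable_indicator) simp
  have pw: "indicator S z * ennreal (norm z powr (-s)) \<le> (\<Sum>j. g j z)" for z
  proof (cases "z \<in> S \<and> z \<noteq> 0")
    case True
    then obtain j where j: "\<rho> j \<le> norm z" "norm z \<le> 2 * \<rho> j" using cover by blast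
    have "(norm z / \<rho> j) powr (-s) \<le> C"
    proof (cases "s \<ge> 0")
      case True
      have "(norm z / \<rho> j) powr (-s) \<le> 1 powr (-s)"
        using True j pos[of j] by (intro powr_mono2') (auto simp: field_simps)
      also have "\<dots> \<le> C" unfolding C_def by (simp add: ge_one_powr_ge_zero)
      finally show ?thesis .
    next
      case False
      have "(norm z / \<rho> j) powr (-s) \<le> 2 powr (-s)"
        using False j pos[of j] by (intro powr_mono2) (auto simp: field_simps)
      then show ?thesis using False by (simp add: C_def)
    qed
    then have "norm z powr (-s) \<le> C * \<rho> j powr (-s)"
      using pos[of j] by (simp add: powr_divide field_simps)
    then have "indicator S z * ennreal (norm z powr (-s)) \<le> g j z"
      using j True by (simp add: g_def ennreal_leI)
    also have "\<dots> \<le> (\<Sum>j. g j z)"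
      using sum_le_suminf[of "\<lambda>j. g j z" "{j}"] by simp
    finally show ?thesis .
  next
    case False
    then show ?thesis by (auto simp: indicator_def)
  qed
  have "(\<integral>\<^sup>+z. indicator S z * ennreal (norm z powr (-s)) \<partial>lborel) \<le> (\<integral>\<^sup>+z. (\<Sum>j. g j z) \<partial>lborel)"
    by (intro nn_integral_mono pw)
  also have "\<dots> = (\<Sum>j. \<integral>\<^sup>+z. g j z \<partial>lborel)"
    by (rule nn_integral_suminf) simp
  also have "\<dots> = (\<Sum>j. ennreal (C * unit_ball_vol (real DIM('a)) * 2 ^ DIM('a) * \<rho> j powr (real DIM('a) - s)))"
  proof (intro arg_cong[of _ _ suminf] ext)
    fix j
    have "(\<integral>\<^sup>+z. g j z \<partial>lborel) = ennreal (C * \<rho> j powr (-s)) * emeasure lborel (cball (0::'a) (2 * \<rho> j))"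
      unfolding g_def by (rule nn_integral_cmult_indicator) simp
    also have "\<dots> = ennreal (C * \<rho> j powr (-s) * (unit_ball_vol (real DIM('a)) * (2 * \<rho> j) ^ DIM('a)))"
      using pos[of j] by (simp add: emeasure_cball C_def ennreal_mult less_imp_le)
    also have "C * \<rho> j powr (-s) * (unit_ball_vol (real DIM('a)) * (2 * \<rho> j) ^ DIM('a))
        = C * unit_ball_vol (real DIM('a)) * 2 ^ DIM('a) * (\<rho> j powr (-s) * \<rho> j powr real DIM('a))"
      using pos[of j] by (simp add: power_mult_distrib powr_realpow)
    also have "\<rho> j powr (-s) * \<rho> j powr real DIM('a) = \<rho> j powr (real DIM('a) - s)"
      by (simp add: powr_add[symmetric])
    finally show "(\<integral>\<^sup>+z. g j z \<partial>lborel) =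
        ennreal (C * unit_ball_vol (real DIM('a)) * 2 ^ DIM('a) * \<rho> j powr (real DIM('a) - s))" .
  qed
  also have "\<dots> < \<infinity>"
  proof -
    have "summable (\<lambda>j. C * unit_ball_vol (real DIM('a)) * 2 ^ DIM('a) * \<rho> j powr (real DIM('a) - s))"
      by (intro summable_mult summ)
    moreover have "0 \<le> C * unit_ball_vol (real DIM('a)) * 2 ^ DIM('a) * \<rho> j powr (real DIM('a) - s)" for j
      by (simp add: C_def)
    ultimately show ?thesis by (subst suminf_ennreal2) auto
  qed
  finally show ?thesis .
qed

lemma dyadic_scale:
  fixes x :: real
  assumes "x \<ge> 1"
  shows "\<exists>j::nat. 2 ^ j \<le> x \<and> x \<le> 2 * 2 ^ j"
proof -
  define j where "j = nat \<lfloor>log 2 x\<rfloor>"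
  have "0 \<le> log 2 x" using assms by simp
  then have "real j \<le> log 2 x" "log 2 x \<le> real j + 1"
    unfolding j_def by linarith+
  then have "2 powr real j \<le> x" "x \<le> 2 powr (real j + 1)"
    using assms by (simp_all add: le_log_iff log_le_iff)
  then show ?thesis by (auto simp: powr_realpow powr_add intro!: exI[of _ j])
qed

text \<open>Scaling by \<open>R\<close> extracts the power of \<open>R\<close> and leaves the case R
  = 1, where the shells of radius 2^j give a geometric series of ratio 2^(d-s) < 1.\<close>

lemma nn_integral_norm_powr_outside:
  fixes s :: real
  assumes s: "s > real DIM('a::euclidean_space)"
  obtains C where "C \<ge> 0" "\<And>R. R > 0 \<Longrightarrow>
    (\<integral>\<^sup>+z. indicator {z::'a. R \<le> norm z} z * ennreal (norm z powr (-s)) \<partial>lborel)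
      \<le> ennreal (C * R powr (real DIM('a) - s))"
proof -
  define I where "I = (\<integral>\<^sup>+z. indicator {z::'a. 1 \<le> norm z} z * ennreal (norm z powr (-s)) \<partial>lborel)"
  have "I < \<infinity>" unfolding I_def
  proof (rule nn_integral_powr_norm_finite[where \<rho> = "\<lambda>j. 2 ^ j"])
    show "summable (\<lambda>j. (2 ^ j) powr (real DIM('a) - s))"
    proof -
      have "(2 ^ j) powr (real DIM('a) - s) = (2 powr (real DIM('a) - s)) ^ j" for j :: nat
        by (simp add: powr_realpow[symmetric] powr_powr mult.commute)
      moreover have "2 powr (real DIM('a) - s) < 1" using s by (simp add: powr_less_one)
      ultimately show ?thesis by (simp add: summable_geometric)
    qed
  qed (use dyadic_scale in auto)
  define C where "C = enn2real I"
  have IC: "I = ennreal C" using \<open>I < \<infinity>\<close> by (simp add: C_def)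
  have C0: "C \<ge> 0" by (simp add: C_def)
  have "(\<integral>\<^sup>+z. indicator {z::'a. R \<le> norm z} z * ennreal (norm z powr (-s)) \<partial>lborel)
      \<le> ennreal (C * R powr (real DIM('a) - s))" if R: "R > 0" for R
  proof -
    have "(\<integral>\<^sup>+z. indicator {z::'a. R \<le> norm z} z * ennreal (norm z powr (-s)) \<partial>lborel)
      = ennreal (\<bar>R\<bar> ^ DIM('a)) * (\<integral>\<^sup>+z. indicator {z::'a. R \<le> norm z} (0 + R *\<^sub>R z) * ennreal (norm (0 + R *\<^sub>R z) powr (-s)) \<partial>lborel)"
      using R by (intro nn_integral_lborel_affine) auto
    also have "(\<integral>\<^sup>+z. indicator {z::'a. R \<le> norm z} (0 + R *\<^sub>R z) * ennreal (norm (0 + R *\<^sub>R z) powr (-s)) \<partial>lborel)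
       = (\<integral>\<^sup>+z. ennreal (R powr (-s)) * (indicator {z::'a. 1 \<le> norm z} z * ennreal (norm z powr (-s))) \<partial>lborel)"
      using R by (intro nn_integral_cong) (auto simp: indicator_def powr_mult ennreal_mult)
    also have "\<dots> = ennreal (R powr (-s)) * I"
      unfolding I_def by (rule nn_integral_cmult) simp
    also have "ennreal (\<bar>R\<bar> ^ DIM('a)) * (ennreal (R powr (-s)) * I) = ennreal (C * (R powr real DIM('a) * R powr (-s)))"
      using R C0 by (simp add: IC ennreal_mult[symmetric] powr_realpow mult_ac)
    also have "R powr real DIM('a) * R powr (-s) = R powr (real DIM('a) - s)"
      by (simp add: powr_add[symmetric])
    finally show ?thesis by simp
  qed
  with C0 show thesis using that by blast
qed

lemma nn_integral_norm_powr_inside: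
  fixes s :: real
  assumes s: "s < real DIM('a::euclidean_space)"
  obtains C where "C \<ge> 0" "\<And>R. R > 0 \<Longrightarrow>
    (\<integral>\<^sup>+z. indicator {z::'a. norm z \<le> R} z * ennreal (norm z powr (-s)) \<partial>lborel)
      \<le> ennreal (C * R powr (real DIM('a) - s))"
proof -
  define I where "I = (\<integral>\<^sup>+z. indicator {z::'a. norm z \<le> 1} z * ennreal (norm z powr (-s)) \<partial>lborel)"
  \<comment> \<open>The shells are [2^(-j-1), 2^(-j)], so the outermost one ends exactly at the unit
    sphere.\<close>
  have "I < \<infinity>" unfolding I_def
  proof (rule nn_integral_powr_norm_finite[where \<rho> = "\<lambda>j. 1 / (2 * 2 ^ j)"])
    show "summable (\<lambda>j. (1 / (2 * 2 ^ j)) powr (real DIM('a) - s))"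
    proof -
      have "(1 / (2 * 2 ^ j)) powr (real DIM('a) - s)
          = 2 powr (s - real DIM('a)) * (2 powr (s - real DIM('a))) ^ j" for j :: nat
      proof -
        have "1 / (2 * 2 ^ j) = 2 powr (- (1 + real j))"
          unfolding powr_minus powr_add by (simp add: powr_realpow field_simps)
        then have "(1 / (2 * 2 ^ j)) powr (real DIM('a) - s) = 2 powr ((s - real DIM('a)) * (1 + real j))"
          by (simp add: powr_powr algebra_simps)
        also have "\<dots> = 2 powr (s - real DIM('a)) * (2 powr (s - real DIM('a))) ^ j"
          by (simp add: powr_realpow[symmetric] powr_powr powr_add[symmetric] algebra_simps)
        finally show ?thesis .
      qed
      moreover have "2 powr (s - real DIM('a)) < 1" using s by (simp add: powr_less_one)
      ultimately show ?thesis by (simp add: summable_geometric summable_mult)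
    qed
    fix z :: 'a assume "z \<in> {z. norm z \<le> 1}" "z \<noteq> 0"
    then have "1 / norm z \<ge> 1" by simp
    then obtain j where "2 ^ j \<le> 1 / norm z" "1 / norm z \<le> 2 * 2 ^ j" using dyadic_scale by blast
    then show "\<exists>j. 1 / (2 * 2 ^ j) \<le> norm z \<and> norm z \<le> 2 * (1 / (2 * 2 ^ j))"
      using \<open>z \<noteq> 0\<close> by (intro exI[of _ j]) (auto simp: field_simps)
  qed auto
  define C where "C = enn2real I"
  have IC: "I = ennreal C" using \<open>I < \<infinity>\<close> by (simp add: C_def)
  have C0: "C \<ge> 0" by (simp add: C_def)
  have "(\<integral>\<^sup>+z. indicator {z::'a. norm z \<le> R} z * ennreal (norm z powr (-s)) \<partial>lborel)
      \<le> ennreal (C * R powr (real DIM('a) - s))" if R: "R > 0" for R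
  proof -
    have "(\<integral>\<^sup>+z. indicator {z::'a. norm z \<le> R} z * ennreal (norm z powr (-s)) \<partial>lborel)
      = ennreal (\<bar>R\<bar> ^ DIM('a)) * (\<integral>\<^sup>+z. indicator {z::'a. norm z \<le> R} (0 + R *\<^sub>R z) * ennreal (norm (0 + R *\<^sub>R z) powr (-s)) \<partial>lborel)"
      using R by (intro nn_integral_lborel_affine) auto
    also have "(\<integral>\<^sup>+z. indicator {z::'a. norm z \<le> R} (0 + R *\<^sub>R z) * ennreal (norm (0 + R *\<^sub>R z) powr (-s)) \<partial>lborel)
       = (\<integral>\<^sup>+z. ennreal (R powr (-s)) * (indicator {z::'a. norm z \<le> 1} z * ennreal (norm z powr (-s))) \<partial>lborel)"
      using R by (intro nn_integral_cong) (auto simp: indicator_def powr_mult ennreal_mult)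
    also have "\<dots> = ennreal (R powr (-s)) * I"
      unfolding I_def by (rule nn_integral_cmult) simp
    also have "ennreal (\<bar>R\<bar> ^ DIM('a)) * (ennreal (R powr (-s)) * I) = ennreal (C * (R powr real DIM('a) * R powr (-s)))"
      using R C0 by (simp add: IC ennreal_mult[symmetric] powr_realpow mult_ac)
    also have "R powr real DIM('a) * R powr (-s) = R powr (real DIM('a) - s)"
      by (simp add: powr_add[symmetric])
    finally show ?thesis by simp
  qed
  with C0 show thesis using that by blast
qed

section \<open>Derivatives along lines and integration by parts\<close>

lemma has_real_derivative_line:
  fixes f :: "'a::real_normed_vector \<Rightarrow> real"
  assumes "\<And>x. ((\<lambda>t. f (x + t *\<^sub>R b)) has_real_derivative f' x) (at 0)"
  shows "((\<lambda>t. f (x + t *\<^sub>R b)) has_real_derivative f' (x + t *\<^sub>R b)) (at t)"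
proof -
  have "((\<lambda>h. f (x + (t + h) *\<^sub>R b)) has_real_derivative f' (x + t *\<^sub>R b)) (at 0)"
    using assms[of "x + t *\<^sub>R b"] by (simp add: algebra_simps)
  then show ?thesis
    using DERIV_shift[of "\<lambda>t. f (x + t *\<^sub>R b)" "f' (x + t *\<^sub>R b)" 0 t]
    by (simp add: add.commute)
qed

lemma integrable_continuous_bounded_support:
  fixes F :: "'a::euclidean_space \<Rightarrow> real"
  assumes "continuous_on UNIV F" "\<And>x. norm x > R \<Longrightarrow> F x = 0"
  shows "integrable lborel F"
proof -
  have "set_integrable lborel (cball 0 R) F"
    unfolding set_integrable_def
    by (intro borel_integrable_compact) (auto intro: continuous_on_subset[OF assms(1)])
  moreover have "indicator (cball 0 R) x *\<^sub>R F x = F x" for x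
    using assms(2)[of x] by (auto simp: indicator_def)
  ultimately show ?thesis by (simp only: set_integrable_def)
qed

lemma line_derivative_zero_outside:
  fixes F F' :: "'a::euclidean_space \<Rightarrow> real"
  assumes D: "\<And>x. ((\<lambda>t. F (x + t *\<^sub>R b)) has_real_derivative F' x) (at 0)"
    and S: "closed S" "\<And>x. x \<notin> S \<Longrightarrow> F x = 0" and x: "x \<notin> S"
  shows "F' x = 0"
proof -
  have "\<forall>\<^sub>F t in nhds 0. x + t *\<^sub>R b \<in> - S"
  proof (rule topological_tendstoD)
    show "((\<lambda>t. x + t *\<^sub>R b) \<longlongrightarrow> x) (nhds 0)"
      using tendsto_add[OF tendsto_const[of x] tendsto_scaleR[OF filterlim_ident[of "nhds (0::real)"] tendsto_const[of b]]]
      by simp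
  qed (use S x in auto)
  then have "\<forall>\<^sub>F t in nhds 0. F (x + t *\<^sub>R b) = 0"
    by eventually_elim (use S in auto)
  then have "((\<lambda>t. F (x + t *\<^sub>R b)) has_real_derivative 0) (at 0)"
    by (subst DERIV_cong_ev[where g = "\<lambda>_. 0"]) auto
  then show ?thesis using D[of x] DERIV_unique by blast
qed

text \<open>Translation invariance does the work: every difference quotient \<open>h n\<close> has
  integral 0, and the quotients converge to \<open>F'\<close> under a fixed integrable
  bound.\<close>

lemma integral_line_derivative_eq_0:
  fixes F F' :: "'a::euclidean_space \<Rightarrow> real"
  assumes D: "\<And>x. ((\<lambda>t. F (x + t *\<^sub>R b)) has_real_derivative F' x) (at 0)"
    and cF: "continuous_on UNIV F" and cF': "continuous_on UNIV F'"
    and supp: "\<And>x. norm x > R \<Longrightarrow> F x = 0"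
  shows "(LINT x|lborel. F' x) = 0"
proof -
  have supp': "F' x = 0" if "norm x > R" for x
    by (rule line_derivative_zero_outside[OF D, of "cball 0 R"]) (use that supp in auto)
  have [measurable]: "F \<in> borel_measurable borel" "F' \<in> borel_measurable borel"
    using cF cF' by (auto intro: borel_measurable_continuous_onI)
  have "bounded (F' ` cball 0 R)"
    by (intro compact_imp_bounded compact_continuous_image continuous_on_subset[OF cF']) auto
  then obtain B0 where B0: "\<And>x. x \<in> cball 0 R \<Longrightarrow> norm (F' x) \<le> B0"
    unfolding bounded_iff by blast
  define B where "B = max B0 0"
  have B: "\<bar>F' x\<bar> \<le> B" for x
    using B0[of x] supp'[of x] by (cases "norm x \<le> R") (auto simp: B_def)
  define h where "h n x = (F (x + (1 / real (Suc n)) *\<^sub>R b) - F x) * real (Suc n)" for n :: nat and x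
  have intF: "integrable lborel F"
    by (rule integrable_continuous_bounded_support[OF cF supp])
  have int_h: "(LINT x|lborel. h n x) = 0" for n
  proof -
    have "(LINT x|lborel. F x) = (LINT x|lborel. F ((1 / real (Suc n)) *\<^sub>R b + 1 *\<^sub>R x))"
      by (subst integral_lborel_affine[of F 1 "(1 / real (Suc n)) *\<^sub>R b"]) auto
    moreover have "integrable lborel (\<lambda>x. F ((1 / real (Suc n)) *\<^sub>R b + x))"
    proof (rule integrable_continuous_bounded_support)
      show "continuous_on UNIV (\<lambda>x. F ((1 / real (Suc n)) *\<^sub>R b + x))"
        by (intro continuous_on_compose2[OF cF] continuous_intros) auto
      show "F ((1 / real (Suc n)) *\<^sub>R b + x) = 0" if "norm x > R + norm ((1 / real (Suc n)) *\<^sub>R b)" for x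
        using that norm_triangle_ineq2[of x "- ((1 / real (Suc n)) *\<^sub>R b)"]
        by (intro supp) (auto simp: add.commute)
    qed
    ultimately show ?thesis using intF by (simp add: h_def add.commute)
  qed
  have "(\<lambda>n. LINT x|lborel. h n x) \<longlonglongrightarrow> (LINT x|lborel. F' x)"
  proof (rule integral_dominated_convergence[where w = "\<lambda>x. B * indicator (cball 0 (R + norm b)) x"])
    show "integrable lborel (\<lambda>x. B * indicator (cball (0::'a) (R + norm b)) x)"
      by (intro integrable_mult_right integrable_real_indicator) (auto simp: emeasure_lborel_cball_finite[simplified])
    show "AE x in lborel. (\<lambda>n. h n x) \<longlonglongrightarrow> F' x"
    proof (rule AE_I2)
      fix x
      have "((\<lambda>t. (F (x + t *\<^sub>R b) - F x) / t) \<longlongrightarrow> F' x) (at 0)"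
        using D[of x] by (simp add: DERIV_def)
      moreover have "filterlim (\<lambda>n. 1 / real (Suc n)) (at 0) sequentially"
        using LIMSEQ_inverse_real_of_nat by (intro filterlim_atI) (auto simp: inverse_eq_divide)
      ultimately have "(\<lambda>n. (F (x + (1 / real (Suc n)) *\<^sub>R b) - F x) / (1 / real (Suc n))) \<longlonglongrightarrow> F' x"
        by (rule filterlim_compose)
      then show "(\<lambda>n. h n x) \<longlonglongrightarrow> F' x" by (simp add: h_def)
    qed
    show "AE x in lborel. norm (h n x) \<le> B * indicator (cball 0 (R + norm b)) x" for n
    proof (rule AE_I2)
      fix x
      define e where "e = 1 / real (Suc n)"
      have e: "0 < e" "e \<le> 1" by (auto simp: e_def)
      \<comment> \<open>The quotient is a value of \<open>F'\<close> at a point at distance at most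
        \<open>norm b\<close> from x. This gives the bound B and explains the radius
        \<open>R + norm b\<close> of the dominating function.\<close>
      have "\<exists>z. z > 0 \<and> z < e \<and> F (x + e *\<^sub>R b) - F (x + 0 *\<^sub>R b) = (e - 0) * F' (x + z *\<^sub>R b)"
        by (rule MVT2[OF e(1)]) (rule has_real_derivative_line[OF D])
      then obtain z where z: "z > 0" "z < e" "F (x + e *\<^sub>R b) - F x = e * F' (x + z *\<^sub>R b)" by auto
      then have hz: "h n x = F' (x + z *\<^sub>R b)"
        unfolding h_def e_def[symmetric] by (simp add: e_def)
      show "norm (h n x) \<le> B * indicator (cball 0 (R + norm b)) x"
      proof (cases "norm x \<le> R + norm b")
        case True
        then show ?thesis using B hz by simp
      next
        case False
        have "norm (z *\<^sub>R b) \<le> norm b" using z e by (simp add: mult_left_le_one_le)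
        then have "norm (x + z *\<^sub>R b) > R"
          using False norm_triangle_ineq2[of x "- (z *\<^sub>R b)"] by auto
        then show ?thesis using hz supp' by (simp add: B_def)
      qed
    qed
  qed (auto simp: h_def)
  then show ?thesis by (simp add: int_h LIMSEQ_const_iff)
qed

section \<open>The regularised kernel\<close>

text \<open>The derivative of \<psi>(x - y) u(y) in y along c integrates to zero. Both sides carry a
  plus sign because differentiating x - y already produces a minus.\<close>

lemma convolution_line_derivative:
  fixes \<psi> \<psi>' u u' :: "'a::euclidean_space \<Rightarrow> real"
  assumes D\<psi>: "\<And>z. ((\<lambda>t. \<psi> (z + t *\<^sub>R c)) has_real_derivative \<psi>' z) (at 0)"
    and Du: "\<And>z. ((\<lambda>t. u (z + t *\<^sub>R c)) has_real_derivative u' z) (at 0)"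
    and [continuous_intros]: "continuous_on UNIV \<psi>" "continuous_on UNIV \<psi>'" "continuous_on UNIV u" "continuous_on UNIV u'"
    and supp: "\<And>z. norm z > R \<Longrightarrow> u z = 0"
  shows "(LINT y|lborel. \<psi> (x - y) * u' y) = (LINT y|lborel. \<psi>' (x - y) * u y)"
proof -
  have supp': "u' z = 0" if "norm z > R" for z
    by (rule line_derivative_zero_outside[OF Du, of "cball 0 R"]) (use that supp in auto)
  have c\<psi>: "continuous_on UNIV (\<lambda>y. \<psi> (x - y))" "continuous_on UNIV (\<lambda>y. \<psi>' (x - y))"
    by (rule continuous_on_compose2[OF assms(3)] continuous_on_compose2[OF assms(4)]; auto intro!: continuous_intros)+
  have D: "((\<lambda>t. \<psi> (x - (y + t *\<^sub>R c)) * u (y + t *\<^sub>R c)) has_real_derivative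
       \<psi> (x - y) * u' y - \<psi>' (x - y) * u y) (at 0)" for y
  proof -
    have "((\<lambda>t. \<psi> ((x - y) + (- t) *\<^sub>R c)) has_real_derivative \<psi>' (x - y) * (- 1)) (at 0)"
      by (rule DERIV_chain2[where f = "\<lambda>t. \<psi> ((x - y) + t *\<^sub>R c)" and g = uminus])
         (use D\<psi>[of "x - y"] in \<open>auto intro!: derivative_eq_intros\<close>)
    then have "((\<lambda>t. \<psi> (x - (y + t *\<^sub>R c))) has_real_derivative - \<psi>' (x - y)) (at 0)"
      by (simp add: algebra_simps)
    from DERIV_mult[OF this Du[of y]] show ?thesis by (simp add: algebra_simps)
  qed
  have "(LINT y|lborel. \<psi> (x - y) * u' y - \<psi>' (x - y) * u y) = 0"
    by (rule integral_line_derivative_eq_0[OF D, where R = R])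
       (auto intro!: continuous_intros c\<psi> simp: supp)
  moreover have "integrable lborel (\<lambda>y. \<psi> (x - y) * u' y)" "integrable lborel (\<lambda>y. \<psi>' (x - y) * u y)"
    by (rule integrable_continuous_bounded_support[where R = R]; auto intro!: continuous_intros c\<psi> simp: supp supp')+
  ultimately show ?thesis by simp
qed

lemma norm_sq_plus_powr_line_derivative:
  fixes z c :: "'a::euclidean_space"
  assumes "z \<noteq> 0 \<or> e \<noteq> 0"
  shows "((\<lambda>t. (norm (z + t *\<^sub>R c) ^ 2 + e ^ 2) powr p) has_real_derivative
      2 * p * (z \<bullet> c) * (norm z ^ 2 + e ^ 2) powr (p - 1)) (at 0)"
proof -
  have pos: "z \<bullet> z + e\<^sup>2 > 0" using assms by (auto simp: add_nonneg_pos add_pos_nonneg)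
  have q: "((\<lambda>t. z \<bullet> z + 2 * t * (z \<bullet> c) + t ^ 2 * (c \<bullet> c) + e ^ 2) has_real_derivative 2 * (z \<bullet> c)) (at 0)"
    by (rule derivative_eq_intros refl)+ simp
  have "((\<lambda>t. (z \<bullet> z + 2 * t * (z \<bullet> c) + t ^ 2 * (c \<bullet> c) + e ^ 2) powr p) has_real_derivative
      (p * (z \<bullet> z + e ^ 2) powr (p - 1)) * (2 * (z \<bullet> c))) (at 0)"
    by (rule DERIV_chain2[OF _ q]) (use has_real_derivative_powr[OF pos, of p] in simp)
  moreover have "norm (z + t *\<^sub>R c) ^ 2 + e ^ 2 = z \<bullet> z + 2 * t * (z \<bullet> c) + t ^ 2 * (c \<bullet> c) + e ^ 2" for t
    unfolding power2_norm_eq_inner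
    by (simp add: inner_add_left inner_add_right inner_commute power2_eq_square)
  ultimately show ?thesis by (simp add: power2_norm_eq_inner mult_ac)
qed

context
  fixes e :: real
begin

text \<open>A component of z / |z|^d with |z| replaced by sqrt(|z|^2 + e^2). It is still a gradient
  field, now smooth at the origin. The functions \<open>newton_reg_d1\<close> and
  \<open>newton_reg_d2\<close> are its first and second derivatives along c.\<close>

definition newton_reg :: "'a::euclidean_space \<Rightarrow> 'a \<Rightarrow> real" where
  "newton_reg b z = (z \<bullet> b) * (norm z ^ 2 + e ^ 2) powr (- real DIM('a) / 2)"

definition newton_reg_d1 :: "'a::euclidean_space \<Rightarrow> 'a \<Rightarrow> 'a \<Rightarrow> real" where
  "newton_reg_d1 b c z = (c \<bullet> b) * (norm z ^ 2 + e ^ 2) powr (- real DIM('a) / 2)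
     - real DIM('a) * (z \<bullet> b) * (z \<bullet> c) * (norm z ^ 2 + e ^ 2) powr (- real DIM('a) / 2 - 1)"

definition newton_reg_d2 :: "'a::euclidean_space \<Rightarrow> 'a \<Rightarrow> 'a \<Rightarrow> real" where
  "newton_reg_d2 b c z =
     - real DIM('a) * (2 * (c \<bullet> b) * (z \<bullet> c) + (z \<bullet> b) * (c \<bullet> c)) * (norm z ^ 2 + e ^ 2) powr (- real DIM('a) / 2 - 1)
     + real DIM('a) * (real DIM('a) + 2) * (z \<bullet> b) * (z \<bullet> c) ^ 2 * (norm z ^ 2 + e ^ 2) powr (- real DIM('a) / 2 - 2)"

text \<open>The divergence of the regularised field. It equals e^(-d) times the bump for e = 1
  evaluated at z / e, hence is an approximate identity up to its total mass.\<close>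

definition poisson_bump :: "'a::euclidean_space \<Rightarrow> real" where
  "poisson_bump z = real DIM('a) * e ^ 2 * (norm z ^ 2 + e ^ 2) powr (- real DIM('a) / 2 - 1)"

definition poisson_bump_d1 :: "'a::euclidean_space \<Rightarrow> 'a \<Rightarrow> real" where
  "poisson_bump_d1 b z = - real DIM('a) * (real DIM('a) + 2) * e ^ 2 * (z \<bullet> b)
     * (norm z ^ 2 + e ^ 2) powr (- real DIM('a) / 2 - 2)"

lemma inner_line_derivative:
  fixes b c z :: "'a::real_inner"
  shows "((\<lambda>t. (z + t *\<^sub>R c) \<bullet> b) has_real_derivative c \<bullet> b) (at 0)"
  unfolding inner_add_left inner_scaleR_left by (rule derivative_eq_intros refl)+ simp

lemma newton_reg_line_derivative:
  fixes b c z :: "'a::euclidean_space"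
  assumes "e \<noteq> 0"
  shows "((\<lambda>t. newton_reg b (z + t *\<^sub>R c)) has_real_derivative newton_reg_d1 b c z) (at 0)"
  unfolding newton_reg_def newton_reg_d1_def
  by (rule DERIV_cong[OF DERIV_mult[OF inner_line_derivative norm_sq_plus_powr_line_derivative[OF disjI2[OF assms]]]])
     simp

lemma newton_reg_d1_line_derivative:
  fixes b c z :: "'a::euclidean_space"
  assumes "e \<noteq> 0"
  shows "((\<lambda>t. newton_reg_d1 b c (z + t *\<^sub>R c)) has_real_derivative newton_reg_d2 b c z) (at 0)"
proof -
  have e2: "- real DIM('a) / 2 - 1 - 1 = - real DIM('a) / 2 - 2" by simp
  have id: "cb * (2 * (- d / 2) * zc * w1) - ((d * cb * zc + d * zb * cc) * w1 + d * zb * zc * (2 * (- d / 2 - 1) * zc * w2))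
      = - d * (2 * cb * zc + zb * cc) * w1 + d * (d + 2) * zb * zc ^ 2 * w2" for cb zc zb cc w1 w2 d :: real
    by (simp add: algebra_simps power2_eq_square)
  show ?thesis
    unfolding newton_reg_d1_def newton_reg_d2_def id[symmetric]
    by (rule DERIV_cong[OF DERIV_diff[OF DERIV_cmult[OF norm_sq_plus_powr_line_derivative[OF disjI2[OF assms]]]
          DERIV_mult[OF DERIV_mult[OF DERIV_cmult[OF inner_line_derivative] inner_line_derivative]
            norm_sq_plus_powr_line_derivative[OF disjI2[OF assms]]]]])
       (simp only: e2 scaleR_zero_left add_0_right add_0_left mult_ac add_ac)
qed

lemma poisson_bump_line_derivative:
  fixes b z :: "'a::euclidean_space"
  assumes "e \<noteq> 0"
  shows "((\<lambda>t. poisson_bump (z + t *\<^sub>R b)) has_real_derivative poisson_bump_d1 b z) (at 0)"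
proof -
  have e2: "- real DIM('a) / 2 - 1 - 1 = - real DIM('a) / 2 - 2" by simp
  have id: "d * E * (2 * (- d / 2 - 1) * zb * w) = - d * (d + 2) * E * zb * w" for d E zb w :: real
    by (simp add: algebra_simps)
  show ?thesis
    unfolding poisson_bump_def poisson_bump_d1_def id[symmetric]
    by (rule DERIV_cong[OF DERIV_cmult[OF norm_sq_plus_powr_line_derivative[OF disjI2[OF assms]]]])
       (simp only: e2)
qed

lemma continuous_norm_sq_plus_powr:
  assumes "e \<noteq> 0"
  shows "continuous_on S (\<lambda>z::'a::euclidean_space. (norm z ^ 2 + e ^ 2) powr p)"
  using assms by (intro continuous_intros) (simp add: add_nonneg_eq_0_iff)

lemma continuous_newton_reg:
  fixes S :: "'a::euclidean_space set"
  assumes "e \<noteq> 0"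
  shows "continuous_on S (newton_reg b)" "continuous_on S (newton_reg_d1 b c)"
    "continuous_on S (newton_reg_d2 b c)" "continuous_on S poisson_bump" "continuous_on S (poisson_bump_d1 b)"
  unfolding newton_reg_def[abs_def] newton_reg_d1_def[abs_def] newton_reg_d2_def[abs_def]
    poisson_bump_def[abs_def] poisson_bump_d1_def[abs_def]
  by (intro continuous_on_add continuous_on_diff continuous_on_mult continuous_on_const continuous_on_id
      continuous_on_inner continuous_on_power continuous_on_minus continuous_norm_sq_plus_powr[OF assms])+

text \<open>The regularised field is a gradient, so the Laplacian of its b-component is the
  b-derivative of its divergence. The proof checks this by direct computation.\<close>

lemma sum_newton_reg_d2:
  fixes b z :: "'a::euclidean_space"
  assumes "e \<noteq> 0" and b: "b \<in> Basis"
  shows "(\<Sum>c\<in>Basis. newton_reg_d2 b c z) = poisson_bump_d1 b z"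
proof -
  define w where "w = norm z ^ 2 + e ^ 2"
  define d where "d = real DIM('a)"
  have w: "w > 0" using assms unfolding w_def by (simp add: add_nonneg_pos)
  have s1: "(\<Sum>c\<in>Basis. (c \<bullet> b) * (z \<bullet> c)) = z \<bullet> b"
    using b by (simp add: inner_Basis if_distrib[of "\<lambda>r. r * _"] cong: if_cong)
  have s2: "(\<Sum>c\<in>(Basis::'a set). (z \<bullet> b) * (c \<bullet> c)) = d * (z \<bullet> b)"
    by (simp add: d_def)
  have s3: "(\<Sum>c\<in>Basis. (z \<bullet> c) ^ 2) = norm z ^ 2"
    unfolding power2_norm_eq_inner by (simp add: euclidean_inner[of z z] power2_eq_square)
  \<comment> \<open>Over the common power of w the sum contains |z|^2 - w = - e^2, which produces
    the factor e^2 of the bump.\<close>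
  have wp: "w powr (- d / 2 - 1) = w * w powr (- d / 2 - 2)"
  proof -
    have "w powr (1 + (- d / 2 - 2)) = w * w powr (- d / 2 - 2)" using w by (subst powr_add) simp
    moreover have "1 + (- d / 2 - 2) = - d / 2 - 1" by simp
    ultimately show ?thesis by (simp only:)
  qed
  define k1 where "k1 = - d * w powr (- d / 2 - 1)"
  define k2 where "k2 = d * (d + 2) * (z \<bullet> b) * w powr (- d / 2 - 2)"
  have "newton_reg_d2 b c z = 2 * k1 * ((c \<bullet> b) * (z \<bullet> c)) + k1 * ((z \<bullet> b) * (c \<bullet> c)) + k2 * (z \<bullet> c) ^ 2" for c
    unfolding newton_reg_d2_def w_def[symmetric] d_def[symmetric] k1_def k2_def by (simp add: algebra_simps)
  then have "(\<Sum>c\<in>Basis. newton_reg_d2 b c z) =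
      2 * k1 * (\<Sum>c\<in>Basis. (c \<bullet> b) * (z \<bullet> c)) + k1 * (\<Sum>c\<in>(Basis::'a set). (z \<bullet> b) * (c \<bullet> c)) + k2 * (\<Sum>c\<in>Basis. (z \<bullet> c) ^ 2)"
    by (simp only: sum.distrib sum_distrib_left)
  also have "\<dots> = poisson_bump_d1 b z"
    unfolding s1 s2 s3 k1_def k2_def wp poisson_bump_d1_def w_def[symmetric] d_def[symmetric]
    by (simp add: w_def algebra_simps)
  finally show ?thesis .
qed

end

section \<open>Representation of the gradient\<close>

definition newton_kernel :: "'a::euclidean_space \<Rightarrow> 'a \<Rightarrow> real" where
  "newton_kernel b z = (z \<bullet> b) * norm z powr (- real DIM('a))"

lemma newton_kernel_measurable [measurable]: "newton_kernel b \<in> borel_measurable borel"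
  unfolding newton_kernel_def[abs_def] by measurable

lemma abs_newton_kernel_le:
  fixes b z :: "'a::euclidean_space"
  assumes "norm b \<le> 1"
  shows "\<bar>newton_kernel b z\<bar> \<le> norm z powr (1 - real DIM('a))"
proof -
  have "\<bar>z \<bullet> b\<bar> \<le> norm z * norm b" by (rule Cauchy_Schwarz_ineq2)
  also have "\<dots> \<le> norm z" using assms by (simp add: mult_left_le)
  finally have "\<bar>newton_kernel b z\<bar> \<le> norm z * norm z powr (- real DIM('a))"
    by (simp add: newton_kernel_def abs_mult mult_right_mono)
  also have "\<dots> = norm z powr (1 - real DIM('a))"
    by (cases "z = 0") (simp_all add: powr_diff powr_minus divide_inverse)
  finally show ?thesis .
qed

text \<open>Adding e^2 can only lower a negative power. The bound does not depend on
  \<open>e\<close>, so it can serve as the dominating function when \<open>e\<close> tends to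
  0.\<close>

lemma abs_newton_reg_le:
  fixes b z :: "'a::euclidean_space"
  assumes "norm b \<le> 1"
  shows "\<bar>newton_reg e b z\<bar> \<le> norm z powr (1 - real DIM('a))"
proof (cases "z = 0")
  case False
  have "\<bar>z \<bullet> b\<bar> \<le> norm z * norm b" by (rule Cauchy_Schwarz_ineq2)
  also have "\<dots> \<le> norm z" using assms by (simp add: mult_left_le)
  finally have 1: "\<bar>z \<bullet> b\<bar> \<le> norm z" .
  have "(norm z ^ 2 + e ^ 2) powr (- real DIM('a) / 2) \<le> (norm z ^ 2) powr (- real DIM('a) / 2)"
    using False by (intro powr_mono2') auto
  also have "\<dots> = norm z powr (- real DIM('a))"
    using False by (simp add: powr_realpow[symmetric] powr_powr del: powr_numeral)
  finally have "\<bar>newton_reg e b z\<bar> \<le> norm z * norm z powr (- real DIM('a))"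
    using 1 by (simp add: newton_reg_def abs_mult mult_mono)
  also have "\<dots> = norm z powr (1 - real DIM('a))"
    using False by (simp add: powr_diff powr_minus divide_inverse)
  finally show ?thesis .
qed (simp add: newton_reg_def)

lemma newton_reg_tendsto:
  fixes b z :: "'a::euclidean_space"
  assumes "e \<longlonglongrightarrow> 0"
  shows "(\<lambda>n. newton_reg (e n) b z) \<longlonglongrightarrow> newton_kernel b z"
proof (cases "z = 0")
  case False
  have "(\<lambda>n. (norm z ^ 2 + e n ^ 2) powr (- real DIM('a) / 2)) \<longlonglongrightarrow> (norm z ^ 2 + 0 ^ 2) powr (- real DIM('a) / 2)"
    using False by (intro tendsto_intros assms) auto
  moreover have "(norm z ^ 2 + 0 ^ 2) powr (- real DIM('a) / 2) = norm z powr (- real DIM('a))"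
    using False by (simp add: powr_realpow[symmetric] powr_powr del: powr_numeral)
  ultimately show ?thesis
    unfolding newton_reg_def newton_kernel_def by (intro tendsto_mult tendsto_const) simp
qed (simp add: newton_reg_def newton_kernel_def)

lemma integrable_norm_powr_cball:
  fixes x :: "'a::euclidean_space" and s R :: real
  assumes "s < real DIM('a)"
  shows "integrable lborel (\<lambda>y. indicator (cball 0 R) y * norm (x - y) powr (- s))"
proof (rule integrableI_nonneg)
  show [measurable]: "(\<lambda>y. indicator (cball 0 R) y * norm (x - y) powr (- s)) \<in> borel_measurable lborel"
    by (intro borel_measurable_times borel_measurable_indicator) auto
  obtain C where C: "C \<ge> 0" "\<And>R. R > 0 \<Longrightarrow>
    (\<integral>\<^sup>+z. indicator {z::'a. norm z \<le> R} z * ennreal (norm z powr (-s)) \<partial>lborel)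
      \<le> ennreal (C * R powr (real DIM('a) - s))" using nn_integral_norm_powr_inside[OF assms] by blast
  \<comment> \<open>After the reflection y = x - z the singularity sits at the origin, and the ball
    about x lies in the ball of radius Q about 0. The summand 1 only ensures Q > 0.\<close>
  define Q where "Q = \<bar>R\<bar> + norm x + 1"
  have Q: "Q > 0" by (simp add: Q_def add_nonneg_pos)
  have "(\<integral>\<^sup>+y. ennreal (indicator (cball 0 R) y * norm (x - y) powr (- s)) \<partial>lborel)
      = (\<integral>\<^sup>+z. ennreal (indicator (cball 0 R) (x + (-1) *\<^sub>R z) * norm (x - (x + (-1) *\<^sub>R z)) powr (- s)) \<partial>lborel)"
    by (subst nn_integral_lborel_affine[where c = "-1" and t = x]) auto
  also have "\<dots> \<le> (\<integral>\<^sup>+z. indicator {z::'a. norm z \<le> Q} z * ennreal (norm z powr (-s)) \<partial>lborel)"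
  proof (rule nn_integral_mono)
    fix z :: 'a
    have "norm z \<le> Q" if "norm (x - z) \<le> R"
      using that norm_triangle_ineq2[of z x] by (simp add: Q_def norm_minus_commute)
    then show "ennreal (indicator (cball 0 R) (x + (-1) *\<^sub>R z) * norm (x - (x + (-1) *\<^sub>R z)) powr (- s))
        \<le> indicator {z::'a. norm z \<le> Q} z * ennreal (norm z powr (-s))"
      by (auto simp: indicator_def)
  qed
  also have "\<dots> < \<infinity>" using C(2)[OF Q] le_less_trans by fastforce
  finally show "(\<integral>\<^sup>+y. ennreal (indicator (cball 0 R) y * norm (x - y) powr (- s)) \<partial>lborel) < \<infinity>" .
qed auto

text \<open>The bump is at most d on the unit ball and at most d |z|^(-d-2) outside, and the
  exponent d + 2 exceeds the dimension.\<close>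

lemma integrable_poisson_bump: "integrable lborel (poisson_bump 1 :: 'a::euclidean_space \<Rightarrow> real)"
proof (rule integrableI_nonneg)
  define d where "d = real DIM('a)"
  have d: "d > 0" by (simp add: d_def)
  show [measurable]: "(poisson_bump 1 :: 'a \<Rightarrow> real) \<in> borel_measurable lborel"
    using continuous_newton_reg(4)[of 1 UNIV] by (auto intro!: borel_measurable_continuous_onI)
  show "AE x in lborel. 0 \<le> poisson_bump 1 (x::'a)" by (simp add: poisson_bump_def)
  obtain C where C: "C \<ge> 0" "\<And>R. R > 0 \<Longrightarrow>
    (\<integral>\<^sup>+z. indicator {z::'a. R \<le> norm z} z * ennreal (norm z powr (-(d + 2))) \<partial>lborel)
      \<le> ennreal (C * R powr (d - (d + 2)))"
    using nn_integral_norm_powr_outside[where 'a = 'a and s = "d + 2"] unfolding d_def by auto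
  have "(\<integral>\<^sup>+z. ennreal (poisson_bump 1 (z::'a)) \<partial>lborel) \<le>
     (\<integral>\<^sup>+z. ennreal d * indicator (cball (0::'a) 1) z + ennreal d * (indicator {z::'a. 1 \<le> norm z} z * ennreal (norm z powr (-(d + 2)))) \<partial>lborel)"
  proof (rule nn_integral_mono)
    fix z :: 'a
    have pb: "poisson_bump 1 z = d * (norm z ^ 2 + 1) powr (- d / 2 - 1)" by (simp add: poisson_bump_def d_def)
    show "ennreal (poisson_bump 1 z) \<le> ennreal d * indicator (cball (0::'a) 1) z + ennreal d * (indicator {z::'a. 1 \<le> norm z} z * ennreal (norm z powr (-(d + 2))))"
    proof (cases "norm z \<le> 1")
      case True
      have "(norm z ^ 2 + 1) powr (- d / 2 - 1) \<le> 1 powr (- d / 2 - 1)"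
        using d by (intro powr_mono2') auto
      then have "poisson_bump 1 z \<le> d" using d by (simp add: pb mult_left_le)
      then show ?thesis using True by (simp add: ennreal_leI add_increasing2)
    next
      case False
      then have nz: "norm z > 0" by linarith
      have "(norm z ^ 2 + 1) powr (- d / 2 - 1) \<le> (norm z ^ 2) powr (- d / 2 - 1)"
        using d nz by (intro powr_mono2') auto
      also have "(norm z ^ 2) powr (- d / 2 - 1) = norm z powr (- (d + 2))"
      proof -
        have "(norm z ^ 2) powr (- d / 2 - 1) = (norm z powr 2) powr (- d / 2 - 1)" using nz by simp
        also have "\<dots> = norm z powr (2 * (- d / 2 - 1))" by (rule powr_powr)
        also have "2 * (- d / 2 - 1) = - (d + 2)" by simp
        finally show ?thesis .
      qed
      finally have "poisson_bump 1 z \<le> d * norm z powr (- (d + 2))"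
        using d unfolding pb by (intro mult_left_mono) auto
      then show ?thesis using False d by (simp add: ennreal_mult[symmetric] ennreal_leI)
    qed
  qed
  also have "\<dots> = ennreal d * emeasure lborel (cball (0::'a) 1) +
      ennreal d * (\<integral>\<^sup>+z. indicator {z::'a. 1 \<le> norm z} z * ennreal (norm z powr (-(d + 2))) \<partial>lborel)"
    by (subst nn_integral_add)
       (auto simp: nn_integral_cmult nn_integral_cmult_indicator intro!: borel_measurable_times_ennreal borel_measurable_indicator)
  also have "\<dots> < \<infinity>"
    using C(2)[of 1] emeasure_lborel_cball_finite[of "0::'a" 1]
    by (auto simp: ennreal_mult_less_top intro: le_less_trans)
  finally show "(\<integral>\<^sup>+z. ennreal (poisson_bump 1 (z::'a)) \<partial>lborel) < \<infinity>" .
qed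

text \<open>This integral is the constant in front of the gradient in the representation formula;
  positivity allows division by it. A strictly positive integrand with integral 0 would force
  Lebesgue measure to be trivial.\<close>

lemma integral_poisson_bump_pos: "(LINT z|lborel. poisson_bump 1 (z::'a::euclidean_space)) > 0"
proof -
  have pos: "poisson_bump 1 (x::'a) > 0" for x
    by (simp add: poisson_bump_def add_nonneg_eq_0_iff)
  have "(LINT z|lborel. poisson_bump 1 (z::'a)) \<noteq> 0"
  proof
    assume "(LINT z|lborel. poisson_bump 1 (z::'a)) = 0"
    then have "AE x in lborel. poisson_bump 1 (x::'a) = 0"
      using pos by (subst (asm) integral_nonneg_eq_0_iff_AE[OF integrable_poisson_bump]) (auto simp: less_imp_le)
    then have "AE x::'a in lborel. False"
      by eventually_elim (metis pos less_irrefl)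
    then have "ae_filter (lborel :: 'a measure) = bot" by (simp add: trivial_limit_def)
    then show False by (simp add: ae_filter_eq_bot_iff)
  qed
  moreover have "(LINT z|lborel. poisson_bump 1 (z::'a)) \<ge> 0"
    using pos by (intro integral_nonneg_AE) (auto simp: less_imp_le)
  ultimately show ?thesis by simp
qed

text \<open>The derivatives are carried as data: \<open>f1 b\<close> and \<open>f2 b\<close> are the
  first and the pure second derivative along the basis vector b. Estimates stated outside the locale
  can then fix their constant before quantifying over all its instances.\<close>

locale annular_C2 =
  fixes f :: "'a::euclidean_space \<Rightarrow> real" and f1 f2 :: "'a \<Rightarrow> 'a \<Rightarrow> real" and r R :: real
  assumes D1: "\<And>b x. b \<in> Basis \<Longrightarrow> ((\<lambda>t. f (x + t *\<^sub>R b)) has_real_derivative f1 b x) (at 0)"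
    and D2: "\<And>b x. b \<in> Basis \<Longrightarrow> ((\<lambda>t. f1 b (x + t *\<^sub>R b)) has_real_derivative f2 b x) (at 0)"
    and cont_f: "continuous_on UNIV f"
    and cont_f1: "\<And>b. b \<in> Basis \<Longrightarrow> continuous_on UNIV (f1 b)"
    and cont_f2: "\<And>b. b \<in> Basis \<Longrightarrow> continuous_on UNIV (f2 b)"
    and r_pos: "0 < r"
    and supp_f: "\<And>x. f x \<noteq> 0 \<Longrightarrow> r \<le> norm x \<and> norm x \<le> R"
begin

definition lap :: "'a \<Rightarrow> real" where "lap x = (\<Sum>b\<in>Basis. f2 b x)"

lemma closed_annulus: "closed {x::'a. r \<le> norm x \<and> norm x \<le> R}"
  by (intro closed_Collect_conj closed_Collect_le continuous_intros)

lemma supp_f1: "b \<in> Basis \<Longrightarrow> f1 b x \<noteq> 0 \<Longrightarrow> r \<le> norm x \<and> norm x \<le> R"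
  using line_derivative_zero_outside[OF D1 closed_annulus, of b x] supp_f by auto

lemma supp_f2: "b \<in> Basis \<Longrightarrow> f2 b x \<noteq> 0 \<Longrightarrow> r \<le> norm x \<and> norm x \<le> R"
  using line_derivative_zero_outside[OF D2 closed_annulus, of b x] supp_f1 by auto

lemma supp_lap: "lap x \<noteq> 0 \<Longrightarrow> r \<le> norm x \<and> norm x \<le> R"
  unfolding lap_def using supp_f2 sum.neutral by metis

lemma cont_lap: "continuous_on UNIV lap"
  unfolding lap_def[abs_def] by (intro continuous_intros cont_f2)

lemma lap_measurable [measurable]: "lap \<in> borel_measurable borel"
  by (rule borel_measurable_continuous_onI[OF cont_lap])

lemma lap_bounded: obtains B where "\<And>x. \<bar>lap x\<bar> \<le> B" "B \<ge> 0"
proof -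
  have "bounded (lap ` cball 0 R)"
    by (intro compact_imp_bounded compact_continuous_image continuous_on_subset[OF cont_lap]) auto
  then obtain B where B: "\<And>x. x \<in> cball 0 R \<Longrightarrow> norm (lap x) \<le> B"
    unfolding bounded_iff by blast
  have "\<bar>lap x\<bar> \<le> max B 0" for x using B[of x] supp_lap[of x] by (cases "lap x = 0") auto
  then show thesis by (rule that) simp
qed

lemma f1_bounded: assumes "b \<in> Basis" obtains B where "\<And>x. \<bar>f1 b x\<bar> \<le> B" "B \<ge> 0"
proof -
  have "bounded (f1 b ` cball 0 R)"
    using assms by (intro compact_imp_bounded compact_continuous_image continuous_on_subset[OF cont_f1]) auto
  then obtain B where B: "\<And>x. x \<in> cball 0 R \<Longrightarrow> norm (f1 b x) \<le> B"
    unfolding bounded_iff by blast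
  have "\<bar>f1 b x\<bar> \<le> max B 0" for x using B[of x] supp_f1[OF assms, of x] by (cases "f1 b x = 0") auto
  then show thesis by (rule that) simp
qed

text \<open>Two integrations by parts move both derivatives of each \<open>f2 c\<close> onto the
  smooth kernel. Summed over c they become the b-derivative of the bump, and a third integration by
  parts returns that derivative to f.\<close>

lemma gradient_representation_reg:
  assumes b: "b \<in> Basis" and e: "e > 0"
  shows "(LINT y|lborel. newton_reg e b (x - y) * lap y)
       = (LINT z|lborel. poisson_bump 1 z * f1 b (x - e *\<^sub>R z))"
proof -
  have e0: "e \<noteq> 0" using e by simp
  have out: "f z = 0" "c \<in> Basis \<Longrightarrow> f1 c z = 0" "c \<in> Basis \<Longrightarrow> f2 c z = 0" if "norm z > R" for z c
    using that supp_f[of z] supp_f1[of c z] supp_f2[of c z] by force+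
  have cshift: "continuous_on UNIV (\<lambda>y. g (x - y))" if "continuous_on UNIV g" for g :: "'a \<Rightarrow> real"
    by (rule continuous_on_compose2[OF that]) (auto intro!: continuous_intros)
  have "(LINT y|lborel. newton_reg e b (x - y) * lap y)
      = (LINT y|lborel. (\<Sum>c\<in>Basis. newton_reg e b (x - y) * f2 c y))"
    by (simp add: lap_def sum_distrib_left)
  also have "\<dots> = (\<Sum>c\<in>Basis. LINT y|lborel. newton_reg e b (x - y) * f2 c y)"
    by (rule Bochner_Integration.integral_sum, rule integrable_continuous_bounded_support[where R = R])
       (auto intro!: continuous_intros cshift continuous_newton_reg[OF e0] cont_f2 simp: out)
  also have "\<dots> = (\<Sum>c\<in>Basis. LINT y|lborel. newton_reg_d2 e b c (x - y) * f y)"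
  proof (rule sum.cong[OF refl])
    fix c :: 'a assume c: "c \<in> Basis"
    have "(LINT y|lborel. newton_reg e b (x - y) * f2 c y) = (LINT y|lborel. newton_reg_d1 e b c (x - y) * f1 c y)"
      by (rule convolution_line_derivative[OF newton_reg_line_derivative[OF e0] D2[OF c], where R = R])
         (auto intro!: continuous_newton_reg[OF e0] cont_f2 cont_f1 c simp: out(1) out(2)[OF _ c])
    also have "\<dots> = (LINT y|lborel. newton_reg_d2 e b c (x - y) * f y)"
      by (rule convolution_line_derivative[OF newton_reg_d1_line_derivative[OF e0] D1[OF c], where R = R])
         (auto intro!: continuous_newton_reg[OF e0] cont_f cont_f1 c simp: out)
    finally show "(LINT y|lborel. newton_reg e b (x - y) * f2 c y) = (LINT y|lborel. newton_reg_d2 e b c (x - y) * f y)" .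
  qed
  also have "\<dots> = (LINT y|lborel. (\<Sum>c\<in>Basis. newton_reg_d2 e b c (x - y) * f y))"
    by (rule Bochner_Integration.integral_sum[symmetric], rule integrable_continuous_bounded_support[where R = R])
       (auto intro!: continuous_intros cshift continuous_newton_reg[OF e0] cont_f simp: out)
  also have "\<dots> = (LINT y|lborel. poisson_bump_d1 e b (x - y) * f y)"
    by (simp add: sum_distrib_right[symmetric] sum_newton_reg_d2[OF e0 b])
  also have "\<dots> = (LINT y|lborel. poisson_bump e (x - y) * f1 b y)"
    by (rule convolution_line_derivative[OF poisson_bump_line_derivative[OF e0] D1[OF b], where R = R, symmetric])
       (auto intro!: continuous_newton_reg[OF e0] cont_f cont_f1 b simp: out)
  \<comment> \<open>The substitution y = x - e z; its Jacobian e^d is exactly what turns the bump of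
    width e into the one of width 1.\<close>
  also have "\<dots> = \<bar>- e\<bar> ^ DIM('a) * (LINT z|lborel. poisson_bump e (x - (x + (- e) *\<^sub>R z)) * f1 b (x + (- e) *\<^sub>R z))"
    by (rule integral_lborel_affine)
       (use e in \<open>auto intro!: borel_measurable_continuous_onI continuous_intros cshift continuous_newton_reg[OF e0] cont_f1 b\<close>)
  also have "\<dots> = (LINT z|lborel. \<bar>- e\<bar> ^ DIM('a) * (poisson_bump e (x - (x + (- e) *\<^sub>R z)) * f1 b (x + (- e) *\<^sub>R z)))"
    by simp
  also have "\<dots> = (LINT z|lborel. poisson_bump 1 z * f1 b (x - e *\<^sub>R z))"
  proof (rule Bochner_Integration.integral_cong[OF refl])
    fix z :: 'a
    define d where "d = real DIM('a)"
    have "e ^ DIM('a) * (e ^ 2 * (norm (e *\<^sub>R z) ^ 2 + e ^ 2) powr (- d / 2 - 1)) = (norm z ^ 2 + 1) powr (- d / 2 - 1)"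
    proof -
      have "norm (e *\<^sub>R z) ^ 2 + e ^ 2 = e ^ 2 * (norm z ^ 2 + 1)"
        by (simp add: power_mult_distrib algebra_simps)
      then have "(norm (e *\<^sub>R z) ^ 2 + e ^ 2) powr (- d / 2 - 1) = (e ^ 2) powr (- d / 2 - 1) * (norm z ^ 2 + 1) powr (- d / 2 - 1)"
        by (simp add: powr_mult)
      moreover have "(e ^ 2) powr (- d / 2 - 1) = e powr (- (d + 2))"
      proof -
        have "(e ^ 2) powr (- d / 2 - 1) = (e powr 2) powr (- d / 2 - 1)" using e by simp
        also have "\<dots> = e powr (2 * (- d / 2 - 1))" by (rule powr_powr)
        also have "2 * (- d / 2 - 1) = - (d + 2)" by simp
        finally show ?thesis .
      qed
      moreover have "e ^ DIM('a) * e ^ 2 = e powr (d + 2)"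
        using e by (simp add: d_def powr_add powr_realpow)
      moreover have "e powr (d + 2) * e powr (- (d + 2)) = 1"
        using e by (simp add: powr_add[symmetric])
      ultimately show ?thesis by (metis mult.assoc mult.left_neutral)
    qed
    then show "\<bar>- e\<bar> ^ DIM('a) * (poisson_bump e (x - (x + (- e) *\<^sub>R z)) * f1 b (x + (- e) *\<^sub>R z))
        = poisson_bump 1 z * f1 b (x - e *\<^sub>R z)"
      using e unfolding poisson_bump_def d_def[symmetric] by (simp add: mult_ac)
  qed
  finally show ?thesis .
qed

text \<open>The limit e -> 0 of the regularised identity. On the left the integrand is dominated by
  a multiple of |x - y|^(1-d) on a ball, which is integrable; on the right by a multiple of the
  bump, while continuity of \<open>f1 b\<close> gives pointwise convergence.\<close>

theorem gradient_representation:
  assumes b: "b \<in> Basis"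
  shows "(LINT y|lborel. newton_kernel b (x - y) * lap y)
       = (LINT z|lborel. poisson_bump 1 (z::'a)) * f1 b x"
proof -
  have [measurable]: "newton_reg e b \<in> borel_measurable borel" for e
    unfolding newton_reg_def[abs_def] by measurable
  have [measurable]: "f1 b \<in> borel_measurable borel" "(poisson_bump 1 :: 'a \<Rightarrow> real) \<in> borel_measurable borel"
    using cont_f1[OF b] continuous_newton_reg(4)[of 1 UNIV] by (auto intro!: borel_measurable_continuous_onI)
  define e where "e n = 1 / real (Suc n)" for n
  have e: "e n > 0" for n by (simp add: e_def)
  have e0: "e \<longlonglongrightarrow> 0"
    using LIMSEQ_inverse_real_of_nat unfolding e_def[abs_def] by (simp add: inverse_eq_divide)
  obtain B where B: "\<And>x. \<bar>lap x\<bar> \<le> B" "B \<ge> 0" using lap_bounded by blast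
  obtain B1 where B1: "\<And>x. \<bar>f1 b x\<bar> \<le> B1" "B1 \<ge> 0" using f1_bounded[OF b] by blast
  have nb: "norm b \<le> 1" using b by simp
  have "(\<lambda>n. LINT y|lborel. newton_reg (e n) b (x - y) * lap y) \<longlonglongrightarrow> (LINT y|lborel. newton_kernel b (x - y) * lap y)"
  proof (rule integral_dominated_convergence[where
        w = "\<lambda>y. B * (indicator (cball 0 R) y * norm (x - y) powr (- (real DIM('a) - 1)))"])
    show "integrable lborel (\<lambda>y. B * (indicator (cball 0 R) y * norm (x - y) powr (- (real DIM('a) - 1))))"
      by (intro integrable_mult_right integrable_norm_powr_cball) simp
    show "AE y in lborel. (\<lambda>n. newton_reg (e n) b (x - y) * lap y) \<longlonglongrightarrow> newton_kernel b (x - y) * lap y"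
      by (intro AE_I2 tendsto_mult tendsto_const newton_reg_tendsto e0)
    show "AE y in lborel. norm (newton_reg (e n) b (x - y) * lap y)
        \<le> B * (indicator (cball 0 R) y * norm (x - y) powr (- (real DIM('a) - 1)))" for n
    proof (rule AE_I2)
      fix y
      have "\<bar>newton_reg (e n) b (x - y)\<bar> * \<bar>lap y\<bar> \<le> norm (x - y) powr (1 - real DIM('a)) * B"
        by (intro mult_mono abs_newton_reg_le nb B) auto
      then show "norm (newton_reg (e n) b (x - y) * lap y)
          \<le> B * (indicator (cball 0 R) y * norm (x - y) powr (- (real DIM('a) - 1)))"
        using supp_lap[of y] by (cases "lap y = 0") (auto simp: abs_mult mult_ac B)
    qed
  qed auto
  moreover have "(\<lambda>n. LINT z|lborel. poisson_bump 1 z * f1 b (x - e n *\<^sub>R z)) \<longlonglongrightarrow> (LINT z::'a|lborel. poisson_bump 1 z * f1 b x)"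
  proof (rule integral_dominated_convergence[where w = "\<lambda>z. B1 * poisson_bump 1 z"])
    show "integrable lborel (\<lambda>z::'a. B1 * poisson_bump 1 z)"
      by (intro integrable_mult_right integrable_poisson_bump)
    show "AE z in lborel. (\<lambda>n. poisson_bump 1 z * f1 b (x - e n *\<^sub>R z)) \<longlonglongrightarrow> poisson_bump 1 z * f1 b x"
    proof (rule AE_I2)
      fix z
      have "(\<lambda>n. x - e n *\<^sub>R z) \<longlonglongrightarrow> x - 0 *\<^sub>R z" by (intro tendsto_intros e0)
      moreover have "isCont (f1 b) x" using cont_f1[OF b] by (simp add: continuous_on_eq_continuous_at)
      ultimately have "(\<lambda>n. f1 b (x - e n *\<^sub>R z)) \<longlonglongrightarrow> f1 b x"
        using isCont_tendsto_compose by force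
      then show "(\<lambda>n. poisson_bump 1 z * f1 b (x - e n *\<^sub>R z)) \<longlonglongrightarrow> poisson_bump 1 z * f1 b x"
        by (intro tendsto_mult tendsto_const)
    qed
    show "AE z in lborel. norm (poisson_bump 1 z * f1 b (x - e n *\<^sub>R z)) \<le> B1 * poisson_bump 1 z" for n
    proof (rule AE_I2)
      fix z :: 'a
      have "0 \<le> poisson_bump 1 z" by (simp add: poisson_bump_def)
      then show "norm (poisson_bump 1 z * f1 b (x - e n *\<^sub>R z)) \<le> B1 * poisson_bump 1 z"
        using B1(1)[of "x - e n *\<^sub>R z"] by (simp add: abs_mult mult.commute[of B1] mult_left_mono)
    qed
  qed auto
  moreover have "(LINT y|lborel. newton_reg (e n) b (x - y) * lap y)
       = (LINT z|lborel. poisson_bump 1 z * f1 b (x - e n *\<^sub>R z))" for n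
    by (rule gradient_representation_reg[OF b e])
  ultimately have "(LINT y|lborel. newton_kernel b (x - y) * lap y) = (LINT z::'a|lborel. poisson_bump 1 z * f1 b x)"
    using LIMSEQ_unique by simp
  then show ?thesis by simp
qed

end

section \<open>Expansion of the kernel\<close>

text \<open>Multiplying by a linear factor shifts coefficients by one, and exactly one term of
  degree N is pushed out of the partial sum. The case distinctions guard the natural-number
  subtractions at 0.\<close>

lemma linear_times_partial_sum:
  fixes \<alpha> \<beta> \<tau> :: real and q :: "nat \<Rightarrow> real"
  shows "(\<alpha> + \<beta> * \<tau>) * (\<Sum>k<N. q k * \<tau> ^ k) =
    (\<Sum>k<N. (\<alpha> * q k + \<beta> * (if k = 0 then 0 else q (k - 1))) * \<tau> ^ k)
      + (if N = 0 then 0 else \<beta> * q (N - 1)) * \<tau> ^ N"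
proof (induction N)
  case (Suc N)
  then show ?case by (cases N) (simp_all add: algebra_simps)
qed simp

text \<open>The factor 3 is 2 + 1: the linear factor is at most 2A and multiplies the old remainder,
  and the term of degree N pushed out of the sum contributes A C. This is used once inside the
  induction for the powers and once for the numerator of the kernel.\<close>

lemma linear_times_expansion_bound:
  fixes \<alpha> \<beta> \<tau> G C A :: real and q :: "nat \<Rightarrow> real"
  assumes G: "\<bar>G - (\<Sum>k<N. q k * \<tau> ^ k)\<bar> \<le> C * \<tau> ^ N"
    and q: "\<And>k. k < N \<Longrightarrow> \<bar>q k\<bar> \<le> C" and C: "C \<ge> 0" and \<tau>: "0 \<le> \<tau>" "\<tau> \<le> 1"
    and \<alpha>: "\<bar>\<alpha>\<bar> \<le> A" and \<beta>: "\<bar>\<beta>\<bar> \<le> A"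
  shows "\<bar>(\<alpha> + \<beta> * \<tau>) * G - (\<Sum>k<N. (\<alpha> * q k + \<beta> * (if k = 0 then 0 else q (k - 1))) * \<tau> ^ k)\<bar>
      \<le> 3 * A * C * \<tau> ^ N"
proof -
  define r where "r = G - (\<Sum>k<N. q k * \<tau> ^ k)"
  define l where "l = (if N = 0 then 0 else \<beta> * q (N - 1))"
  have A: "A \<ge> 0" using \<alpha> by linarith
  have "\<bar>\<beta> * \<tau>\<bar> \<le> A * 1" unfolding abs_mult using \<beta> \<tau> A by (intro mult_mono) auto
  then have lin: "\<bar>\<alpha> + \<beta> * \<tau>\<bar> \<le> 2 * A" using \<alpha> by linarith
  have "\<bar>(\<alpha> + \<beta> * \<tau>) * r\<bar> \<le> (2 * A) * (C * \<tau> ^ N)"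
    unfolding abs_mult using lin G A by (intro mult_mono) (auto simp: r_def)
  moreover have "\<bar>l\<bar> \<le> A * C"
    using \<beta> q[of "N - 1"] A C by (auto simp: l_def abs_mult intro!: mult_mono)
  then have "\<bar>l * \<tau> ^ N\<bar> \<le> A * C * \<tau> ^ N"
    unfolding abs_mult using \<tau> by (intro mult_mono) (auto simp: A C)
  moreover have "(\<alpha> + \<beta> * \<tau>) * G - (\<Sum>k<N. (\<alpha> * q k + \<beta> * (if k = 0 then 0 else q (k - 1))) * \<tau> ^ k)
     = (\<alpha> + \<beta> * \<tau>) * r + l * \<tau> ^ N"
    using linear_times_partial_sum[of \<alpha> \<beta> \<tau> q N] by (simp add: r_def l_def algebra_simps)
  moreover have "3 * A * C * \<tau> ^ N = (2 * A) * (C * \<tau> ^ N) + A * C * \<tau> ^ N" by simp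
  ultimately show ?thesis using abs_triangle_ineq[of "(\<alpha> + \<beta> * \<tau>) * r" "l * \<tau> ^ N"] by linarith
qed

section \<open>Expansion of the generating function of the Gegenbauer polynomials\<close>

lemma gegenbauer_base_bounds:
  fixes c \<tau> :: real
  assumes "\<bar>c\<bar> \<le> 1" "0 \<le> \<tau>" "\<tau> \<le> 1 / 4"
  shows "1 / 2 \<le> 1 - 2 * c * \<tau> + \<tau> ^ 2"
proof -
  have "c * \<tau> \<le> 1 * \<tau>" using assms by (intro mult_right_mono) auto
  then show ?thesis using assms(3) zero_le_power2[of \<tau>] by linarith
qed

text \<open>The \<open>p k\<close> play the part of Gegenbauer polynomials of index \<nu>.
  Differentiating the power in \<tau> gives 2 \<nu> (c - \<tau>) times the power of index \<nu> + 1,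
  so an expansion of order N for \<nu> + 1 integrates to one of order N + 1 for \<nu>. This is why
  the induction on N has to generalise \<nu>.\<close>

lemma gegenbauer_expansion:
  fixes \<nu> :: real
  assumes "\<nu> \<ge> 0"
  shows "\<exists>(p :: nat \<Rightarrow> real \<Rightarrow> real) C. C \<ge> 0 \<and> (\<forall>k. continuous_on UNIV (p k)) \<and>
    (\<forall>k<N. \<forall>c. \<bar>c\<bar> \<le> 1 \<longrightarrow> \<bar>p k c\<bar> \<le> C) \<and>
    (\<forall>c \<tau>. \<bar>c\<bar> \<le> 1 \<longrightarrow> 0 \<le> \<tau> \<longrightarrow> \<tau> \<le> 1 / 4 \<longrightarrow>
       \<bar>(1 - 2 * c * \<tau> + \<tau> ^ 2) powr (- \<nu>) - (\<Sum>k<N. p k c * \<tau> ^ k)\<bar> \<le> C * \<tau> ^ N)"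
  using assms
proof (induction N arbitrary: \<nu>)
  case 0
  have "(1 - 2 * c * \<tau> + \<tau> ^ 2) powr (- \<nu>) \<le> (1 / 2) powr (- \<nu>)"
    if "\<bar>c\<bar> \<le> 1" "0 \<le> \<tau>" "\<tau> \<le> 1 / 4" for c \<tau> :: real
    using gegenbauer_base_bounds[OF that] 0 by (intro powr_mono2') auto
  then show ?case
    by (intro exI[of _ "\<lambda>_ _. 0"] exI[of _ "(1 / 2) powr (- \<nu>)"]) auto
next
  case (Suc N)
  have "\<nu> + 1 \<ge> 0" using Suc.prems by simp
  from Suc.IH[OF this] obtain q C where C: "C \<ge> 0" and cq: "\<And>k. continuous_on UNIV (q k)"
    and qb: "\<And>k c. k < N \<Longrightarrow> \<bar>c\<bar> \<le> 1 \<Longrightarrow> \<bar>q k c\<bar> \<le> C"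
    and ex: "\<And>c \<tau>. \<bar>c\<bar> \<le> 1 \<Longrightarrow> 0 \<le> \<tau> \<Longrightarrow> \<tau> \<le> 1 / 4 \<Longrightarrow>
       \<bar>(1 - 2 * c * \<tau> + \<tau> ^ 2) powr (- (\<nu> + 1)) - (\<Sum>k<N. q k c * \<tau> ^ k)\<bar> \<le> C * \<tau> ^ N"
    by blast
  \<comment> \<open>The m are the coefficients of the derivative, that is of 2 \<nu> (c - \<tau>)
    times the expansion for \<nu> + 1. Integrating term by term from the value 1 at \<tau> = 0 gives
    p.\<close>
  define m where "m k c = 2 * \<nu> * c * q k c + (- 2 * \<nu>) * (if k = 0 then 0 else q (k - 1) c)" for k c
  define p where "p k c = (if k = 0 then 1 else m (k - 1) c / real k)" for k c
  \<comment> \<open>The 1 bounds \<open>p 0\<close>; the rest is the factor 3 A C of the product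
    estimate with A = 2 \<nu>.\<close>
  define C' where "C' = 1 + 6 * \<nu> * C"
  have C': "C' \<ge> 1" "C' \<ge> 0" using Suc.prems C by (auto simp: C'_def)
  have cp: "continuous_on UNIV (p k)" for k
  proof (cases "k = 0")
    case True
    then show ?thesis by (simp add: p_def[abs_def])
  next
    case False
    then show ?thesis
      by (cases "k = 1") (auto simp: p_def[abs_def] m_def intro!: continuous_intros cq)
  qed
  have pb: "\<bar>p k c\<bar> \<le> C'" if k: "k < Suc N" and c: "\<bar>c\<bar> \<le> 1" for k c
  proof (cases "k = 0")
    case True
    then show ?thesis using C' by (simp add: p_def)
  next
    case False
    then obtain j where j: "k = Suc j" "j < N" using k by (cases k) auto
    have "\<bar>2 * \<nu> * c * q j c\<bar> \<le> 2 * \<nu> * 1 * C"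
      unfolding abs_mult using Suc.prems c qb[OF j(2) c] C by (intro mult_mono) auto
    moreover have "\<bar>(- 2 * \<nu>) * (if j = 0 then 0 else q (j - 1) c)\<bar> \<le> 2 * \<nu> * C"
      unfolding abs_mult using Suc.prems c qb[of "j - 1" c] j C by (intro mult_mono) auto
    ultimately have "\<bar>m j c\<bar> \<le> 4 * \<nu> * C" unfolding m_def by linarith
    moreover have "\<bar>p k c\<bar> \<le> \<bar>m j c\<bar>"
      using j by (simp add: p_def field_simps)
    moreover have "\<nu> * C \<ge> 0" using Suc.prems C by simp
    ultimately show ?thesis unfolding C'_def by linarith
  qed
  have "\<bar>(1 - 2 * c * \<tau> + \<tau> ^ 2) powr (- \<nu>) - (\<Sum>k<Suc N. p k c * \<tau> ^ k)\<bar> \<le> C' * \<tau> ^ Suc N"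
    if c: "\<bar>c\<bar> \<le> 1" and \<tau>: "0 \<le> \<tau>" "\<tau> \<le> 1 / 4" for c \<tau> :: real
  proof (cases "\<tau> = 0")
    case True
    then show ?thesis by (simp add: p_def sum.lessThan_Suc_shift del: sum.lessThan_Suc)
  next
    case False
    define h where "h t = (1 - 2 * c * t + t ^ 2) powr (- \<nu>) - (\<Sum>k<Suc N. p k c * t ^ k)" for t
    define h' where "h' t = 2 * \<nu> * (c - t) * (1 - 2 * c * t + t ^ 2) powr (- (\<nu> + 1)) - (\<Sum>k<N. m k c * t ^ k)" for t
    have hs: "h = (\<lambda>t. (1 - 2 * c * t + t ^ 2) powr (- \<nu>) - (1 + (\<Sum>k<N. m k c * (t ^ Suc k / real (Suc k)))))"
      unfolding h_def[abs_def] sum.lessThan_Suc_shift by (simp add: p_def)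
    have D: "(h has_real_derivative h' t) (at t)" if t: "0 \<le> t" "t \<le> \<tau>" for t
    proof -
      have pos: "1 - 2 * c * t + t ^ 2 > 0"
        using gegenbauer_base_bounds[OF c t(1)] t \<tau> by linarith
      have q1: "((\<lambda>t. 1 - 2 * c * t + t ^ 2) has_real_derivative (2 * t - 2 * c)) (at t)"
        by (rule derivative_eq_intros refl)+ simp
      have d1: "((\<lambda>t. (1 - 2 * c * t + t ^ 2) powr (- \<nu>)) has_real_derivative
          (- \<nu> * (1 - 2 * c * t + t ^ 2) powr (- \<nu> - 1)) * (2 * t - 2 * c)) (at t)"
        by (rule DERIV_chain2[OF has_real_derivative_powr[OF pos] q1])
      have d2: "((\<lambda>t. 1 + (\<Sum>k<N. m k c * (t ^ Suc k / real (Suc k)))) has_real_derivative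
          0 + (\<Sum>k<N. m k c * t ^ k)) (at t)"
      proof (intro DERIV_add DERIV_const DERIV_sum DERIV_cmult)
        fix k
        have "((\<lambda>t. t ^ Suc k / real (Suc k)) has_real_derivative (real (Suc k) * t ^ k) / real (Suc k)) (at t)"
          by (intro DERIV_cdivide) (rule DERIV_cong[OF DERIV_pow], simp)
        then show "((\<lambda>t. t ^ Suc k / real (Suc k)) has_real_derivative t ^ k) (at t)" by simp
      qed
      have e: "- \<nu> - 1 = - (\<nu> + 1)" by simp
      have "h' t = (- \<nu> * (1 - 2 * c * t + t ^ 2) powr (- \<nu> - 1)) * (2 * t - 2 * c) - (0 + (\<Sum>k<N. m k c * t ^ k))"
        unfolding h'_def e by (simp add: algebra_simps)
      then show ?thesis using DERIV_diff[OF d1 d2] unfolding hs by simp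
    qed
    have h'b: "\<bar>h' t\<bar> \<le> C' * t ^ N" if t: "0 \<le> t" "t \<le> \<tau>" for t
    proof -
      have l: "2 * \<nu> * (c - t) = 2 * \<nu> * c + (- 2 * \<nu>) * t" by (simp add: algebra_simps)
      have "\<bar>h' t\<bar> \<le> 3 * (2 * \<nu>) * C * t ^ N"
        unfolding h'_def m_def l
      proof (rule linear_times_expansion_bound)
        show "\<bar>2 * \<nu> * c\<bar> \<le> 2 * \<nu>" using c Suc.prems by (simp add: abs_mult mult_left_le)
      qed (use ex c t \<tau> qb C Suc.prems in auto)
      also have "\<dots> \<le> C' * t ^ N" unfolding C'_def using t by (intro mult_right_mono) auto
      finally show ?thesis .
    qed
    \<comment> \<open>Since \<open>h 0 = 0\<close>, the mean value theorem bounds the remainder by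
      \<tau> times its derivative, which supplies the extra power of \<tau>.\<close>
    have "\<exists>z>0. z < \<tau> \<and> h \<tau> - h 0 = (\<tau> - 0) * h' z"
      by (rule MVT2) (use False \<tau> D in auto)
    then obtain z where z: "0 < z" "z < \<tau>" "h \<tau> - h 0 = \<tau> * h' z" by auto
    have "h 0 = 0" unfolding hs by simp
    then have "\<bar>h \<tau>\<bar> = \<tau> * \<bar>h' z\<bar>" using z \<tau> by (simp add: abs_mult)
    also have "\<dots> \<le> \<tau> * (C' * z ^ N)" using z \<tau> by (intro mult_left_mono h'b) auto
    also have "\<dots> \<le> \<tau> * (C' * \<tau> ^ N)" using z \<tau> C' by (intro mult_left_mono power_mono) auto
    finally show ?thesis by (simp add: h_def mult_ac)
  qed
  then show ?case using C' cp pb by blast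
qed

text \<open>Here \<open>D k x y\<close> is the coefficient of s^k in the kernel at s x - y. The
  bound needed later is the case s = 1, but the orthogonality relations come from letting s tend to
  0, so s is kept. Measurability is required in both arguments because the integration variable is y
  for the expansion at the origin and x, after exchanging roles, for the one at infinity.\<close>

definition newton_expansion :: "'a::euclidean_space \<Rightarrow> nat \<Rightarrow> (nat \<Rightarrow> 'a \<Rightarrow> 'a \<Rightarrow> real) \<Rightarrow> real \<Rightarrow> bool" where
  "newton_expansion b N D C \<longleftrightarrow> C \<ge> 0 \<and>
     (\<forall>k x. D k x \<in> borel_measurable borel) \<and> (\<forall>k y. (\<lambda>x. D k x y) \<in> borel_measurable borel) \<and>
     (\<forall>k x y. k < N \<longrightarrow> x \<noteq> 0 \<longrightarrow> y \<noteq> 0 \<longrightarrow>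
       \<bar>D k x y\<bar> \<le> C * norm y powr (1 - real DIM('a)) * (norm x / norm y) ^ k) \<and>
     (\<forall>s x y. x \<noteq> 0 \<longrightarrow> y \<noteq> 0 \<longrightarrow> 0 \<le> s \<longrightarrow> s * norm x \<le> norm y / 4 \<longrightarrow>
       \<bar>newton_kernel b (s *\<^sub>R x - y) - (\<Sum>k<N. D k x y * s ^ k)\<bar>
         \<le> C * norm y powr (1 - real DIM('a)) * (s * norm x / norm y) ^ N)"

lemma newton_expansionD:
  fixes b :: "'a::euclidean_space"
  assumes "newton_expansion b N D C"
  shows "C \<ge> 0"
    "\<And>k x. D k x \<in> borel_measurable borel"
    "\<And>k y. (\<lambda>x. D k x y) \<in> borel_measurable borel"
    "\<And>k x y. k < N \<Longrightarrow> x \<noteq> 0 \<Longrightarrow> y \<noteq> 0 \<Longrightarrow>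
       \<bar>D k x y\<bar> \<le> C * norm y powr (1 - real DIM('a)) * (norm x / norm y) ^ k"
    "\<And>s x y. x \<noteq> 0 \<Longrightarrow> y \<noteq> 0 \<Longrightarrow> 0 \<le> s \<Longrightarrow> s * norm x \<le> norm y / 4 \<Longrightarrow>
       \<bar>newton_kernel b (s *\<^sub>R x - y) - (\<Sum>k<N. D k x y * s ^ k)\<bar>
         \<le> C * norm y powr (1 - real DIM('a)) * (s * norm x / norm y) ^ N"
  using assms unfolding newton_expansion_def by blast+

text \<open>With \<tau> = s |x| / |y| and c the cosine of the angle, the law of cosines writes |s x
  - y|^(-d) as |y|^(-d) times the Gegenbauer generating function of index d / 2. The numerator is
  |y| times a linear function of \<tau> with coefficients at most 1, which gives the constant 3
  C.\<close>

lemma newton_kernel_expansion: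
  fixes b :: "'a::euclidean_space"
  assumes b: "norm b \<le> 1"
  obtains D C where "newton_expansion b N D C"
proof -
  define d where "d = real DIM('a)"
  have "d / 2 \<ge> 0" by (simp add: d_def)
  from gegenbauer_expansion[OF this, of N] obtain p C where C: "C \<ge> 0"
    and cp: "\<And>k. continuous_on UNIV (p k)"
    and pb: "\<And>k c. k < N \<Longrightarrow> \<bar>c\<bar> \<le> 1 \<Longrightarrow> \<bar>p k c\<bar> \<le> C"
    and ex: "\<And>c \<tau>. \<bar>c\<bar> \<le> 1 \<Longrightarrow> 0 \<le> \<tau> \<Longrightarrow> \<tau> \<le> 1 / 4 \<Longrightarrow>
       \<bar>(1 - 2 * c * \<tau> + \<tau> ^ 2) powr (- (d / 2)) - (\<Sum>k<N. p k c * \<tau> ^ k)\<bar> \<le> C * \<tau> ^ N"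
    by blast
  have [measurable]: "p k \<in> borel_measurable borel" for k
    using cp by (rule borel_measurable_continuous_onI)
  define c where "c x y = (x \<bullet> y) / (norm x * norm y)" for x y :: 'a
  define dir where "dir x = (x \<bullet> b) / norm x" for x :: 'a
  define Q where "Q k x y = - dir y * p k (c x y) + dir x * (if k = 0 then 0 else p (k - 1) (c x y))" for k x y
  define D where "D k x y = norm y powr (1 - d) * (Q k x y * (norm x / norm y) ^ k)" for k x y
  \<comment> \<open>Division by zero yields 0, so the bounds on the cosine and on \<open>dir\<close>
    hold for all vectors.\<close>
  have cb: "\<bar>c x y\<bar> \<le> 1" for x y
    using Cauchy_Schwarz_ineq2[of x y] by (auto simp: c_def abs_mult divide_le_eq_1)
  have db: "\<bar>dir x\<bar> \<le> 1" for x
  proof -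
    have "\<bar>x \<bullet> b\<bar> \<le> norm x * norm b" by (rule Cauchy_Schwarz_ineq2)
    also have "\<dots> \<le> norm x" using b by (simp add: mult_left_le)
    finally show ?thesis by (auto simp: dir_def abs_mult divide_le_eq_1)
  qed
  have Qb: "\<bar>Q k x y\<bar> \<le> 2 * C" if "k < N" for k x y
  proof -
    have "\<bar>- dir y * p k (c x y)\<bar> \<le> 1 * C"
      unfolding abs_mult abs_minus_cancel using that cb db pb by (intro mult_mono) auto
    moreover have "\<bar>dir x * (if k = 0 then 0 else p (k - 1) (c x y))\<bar> \<le> 1 * C"
      unfolding abs_mult using that cb db pb C by (intro mult_mono) auto
    ultimately show ?thesis unfolding Q_def by linarith
  qed
  have "newton_expansion b N D (3 * C)"
    unfolding newton_expansion_def
  proof (intro conjI allI impI)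
    show "3 * C \<ge> 0" using C by simp
    show "D k x \<in> borel_measurable borel" "(\<lambda>x. D k x y) \<in> borel_measurable borel" for k x y
      unfolding D_def[abs_def] Q_def dir_def c_def by measurable
    show "\<bar>D k x y\<bar> \<le> 3 * C * norm y powr (1 - real DIM('a)) * (norm x / norm y) ^ k" if "k < N" for k x y
    proof -
      have "\<bar>D k x y\<bar> = norm y powr (1 - d) * (\<bar>Q k x y\<bar> * (norm x / norm y) ^ k)"
        by (simp add: D_def abs_mult)
      also have "\<dots> \<le> norm y powr (1 - d) * (3 * C * (norm x / norm y) ^ k)"
        using Qb[OF that, of x y] C by (intro mult_left_mono mult_right_mono) auto
      finally show ?thesis by (simp add: d_def mult_ac)
    qed
    show "\<bar>newton_kernel b (s *\<^sub>R x - y) - (\<Sum>k<N. D k x y * s ^ k)\<bar>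
         \<le> 3 * C * norm y powr (1 - real DIM('a)) * (s * norm x / norm y) ^ N"
      if x: "x \<noteq> 0" and y: "y \<noteq> 0" and s: "0 \<le> s" "s * norm x \<le> norm y / 4" for s x y
    proof -
      define \<tau> where "\<tau> = s * norm x / norm y"
      have \<tau>: "0 \<le> \<tau>" "\<tau> \<le> 1 / 4" using x y s by (auto simp: \<tau>_def field_simps)
      define G where "G = (1 - 2 * c x y * \<tau> + \<tau> ^ 2) powr (- (d / 2))"
      have "norm (s *\<^sub>R x - y) ^ 2 = norm y ^ 2 * (1 - 2 * c x y * \<tau> + \<tau> ^ 2)"
        using x y unfolding power2_norm_eq_inner
        by (simp add: \<tau>_def c_def field_simps inner_diff_left inner_diff_right inner_commute power2_norm_eq_inner power2_eq_square)
           (simp add: power2_norm_eq_inner[symmetric] power2_eq_square algebra_simps)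
      then have "(norm (s *\<^sub>R x - y) ^ 2) powr (- (d / 2)) = (norm y ^ 2) powr (- (d / 2)) * G"
        using gegenbauer_base_bounds[OF cb \<tau>, of x y] by (simp add: powr_mult G_def)
      moreover have sq: "(norm z ^ 2) powr (- (d / 2)) = norm z powr (- d)" for z :: 'a
        by (cases "z = 0") (simp_all add: powr_powr flip: powr_numeral)
      ultimately have n: "norm (s *\<^sub>R x - y) powr (- d) = norm y powr (- d) * G" by simp
      have lin: "(s *\<^sub>R x - y) \<bullet> b = norm y * (- dir y + dir x * \<tau>)"
        using x y by (simp add: dir_def \<tau>_def inner_diff_left field_simps)
      have yp: "norm y * norm y powr (- d) = norm y powr (1 - d)"
        using y by (simp add: powr_diff powr_minus divide_inverse)
      have K: "newton_kernel b (s *\<^sub>R x - y) = norm y powr (1 - d) * ((- dir y + dir x * \<tau>) * G)"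
        unfolding newton_kernel_def lin d_def[symmetric] n yp[symmetric] by (simp add: mult_ac)
      have "(\<Sum>k<N. D k x y * s ^ k) = norm y powr (1 - d) * (\<Sum>k<N. Q k x y * \<tau> ^ k)"
        unfolding sum_distrib_left by (intro sum.cong refl) (simp add: D_def \<tau>_def power_mult_distrib power_divide)
      then have "\<bar>newton_kernel b (s *\<^sub>R x - y) - (\<Sum>k<N. D k x y * s ^ k)\<bar>
          = norm y powr (1 - d) * \<bar>(- dir y + dir x * \<tau>) * G - (\<Sum>k<N. Q k x y * \<tau> ^ k)\<bar>"
        unfolding K by (simp add: abs_mult flip: right_diff_distrib)
      also have "\<dots> \<le> norm y powr (1 - d) * (3 * 1 * C * \<tau> ^ N)"
        unfolding Q_def
      proof (intro mult_left_mono linear_times_expansion_bound)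
        show "\<bar>G - (\<Sum>k<N. p k (c x y) * \<tau> ^ k)\<bar> \<le> C * \<tau> ^ N"
          unfolding G_def using ex[OF cb \<tau>] .
      qed (use cb db pb C \<tau> in auto)
      finally show ?thesis by (simp add: \<tau>_def d_def mult_ac)
    qed
  qed
  then show thesis by (rule that)
qed

text \<open>Strong induction: once the lower coefficients vanish, s^k factors out. The other factor
  is O(s^(N-k)) with N - k > 0, so its value at 0, which is \<open>a k\<close>, must be 0.\<close>

lemma partial_sum_coeffs_eq_0:
  fixes a :: "nat \<Rightarrow> real"
  assumes s0: "s0 > 0" and small: "\<And>s. 0 < s \<Longrightarrow> s \<le> s0 \<Longrightarrow> \<bar>\<Sum>k<N. a k * s ^ k\<bar> \<le> C * s ^ N"
    and "k < N"
  shows "a k = 0"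
  using \<open>k < N\<close>
proof (induction k rule: less_induct)
  case (less k)
  define g where "g s = (\<Sum>j<N - k. a (j + k) * s ^ j)" for s
  have split: "(\<Sum>i<N. a i * s ^ i) = s ^ k * g s" for s
  proof -
    have "(\<Sum>i<N. a i * s ^ i) = (\<Sum>i<k. a i * s ^ i) + (\<Sum>i=k..<N. a i * s ^ i)"
      using less.prems sum.atLeastLessThan_concat[of 0 k N "\<lambda>i. a i * s ^ i"] by (simp add: atLeast0LessThan)
    also have "(\<Sum>i<k. a i * s ^ i) = 0"
      using less by (intro sum.neutral) auto
    also have "(\<Sum>i=k..<N. a i * s ^ i) = (\<Sum>j<N - k. a (j + k) * s ^ (j + k))"
      using sum.shift_bounds_nat_ivl[of "\<lambda>i. a i * s ^ i" 0 k "N - k"] less.prems by (simp add: atLeast0LessThan)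
    also have "\<dots> = s ^ k * g s"
      by (simp add: g_def sum_distrib_left power_add mult_ac)
    finally show ?thesis by simp
  qed
  have "\<forall>\<^sub>F s in at_right 0. 0 < s \<and> s \<le> s0"
    using s0 by (auto simp: eventually_at_right_field intro!: exI[of _ s0])
  then have ev: "\<forall>\<^sub>F s in at_right 0. norm (g s) \<le> C * s ^ (N - k)"
  proof eventually_elim
    case (elim s)
    have "s ^ k * \<bar>g s\<bar> \<le> C * s ^ N" using small[of s] elim by (simp add: split abs_mult)
    also have "\<dots> = s ^ k * (C * s ^ (N - k))" using less.prems by (simp add: power_add[symmetric])
    finally show ?case using elim by simp
  qed
  have "((\<lambda>s. C * s ^ (N - k)) \<longlongrightarrow> C * 0 ^ (N - k)) (at_right 0)"
    by (intro tendsto_intros)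
  then have "((\<lambda>s. C * s ^ (N - k)) \<longlongrightarrow> 0) (at_right 0)" using less.prems by (simp add: power_0_left)
  from Lim_null_comparison[OF ev this] have "(g \<longlongrightarrow> 0) (at_right 0)" .
  moreover have "(g \<longlongrightarrow> g 0) (at_right 0)"
    unfolding g_def[abs_def] by (intro tendsto_intros)
  ultimately have "g 0 = 0" by (intro tendsto_unique[of "at_right (0::real)" g]) auto
  moreover have "g 0 = a k"
  proof -
    obtain n where "N - k = Suc n" using less.prems by (cases "N - k") auto
    then show ?thesis unfolding g_def by (simp add: sum.lessThan_Suc_shift del: sum.lessThan_Suc)
  qed
  ultimately show ?case by simp
qed

section \<open>Schur's test and Hardy's inequality\<close>

text \<open>Each summand is homogeneous of degree 1 - d, like the kernel. The first keeps the
  diagonal singularity; the others allow the exponent p of x when y is far out and the exponent q of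
  y when x is far out. The regions overlap on comparable norms, and the constant 4 matches the range
  of validity of the expansion.\<close>

definition schur_majorant :: "real \<Rightarrow> real \<Rightarrow> 'a::euclidean_space \<Rightarrow> 'a \<Rightarrow> real" where
  "schur_majorant p q x y =
     (if norm x \<le> 4 * norm y \<and> norm y \<le> 4 * norm x then norm (x - y) powr (1 - real DIM('a)) else 0)
   + (if norm x \<le> 4 * norm y then norm x powr p * norm y powr (1 - real DIM('a) - p) else 0)
   + (if norm y \<le> 4 * norm x then norm x powr (1 - real DIM('a) - q) * norm y powr q else 0)"

lemma schur_majorant_nonneg: "0 \<le> schur_majorant p q x y"
  by (simp add: schur_majorant_def)

text \<open>Transposition exchanges p and q, so one integral estimate yields both Schur conditions,
  and the expansion at infinity is bounded by transposing the one at the origin.\<close>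

lemma schur_majorant_swap: "schur_majorant p q x y = schur_majorant q p y x"
  by (auto simp: schur_majorant_def norm_minus_commute mult.commute)

lemma schur_majorant_measurable [measurable]:
  "case_prod (schur_majorant p q :: 'a::euclidean_space \<Rightarrow> _) \<in> borel_measurable (borel \<Otimes>\<^sub>M borel)"
  unfolding schur_majorant_def[abs_def] by measurable

lemma schur_majorant_measurable' [measurable]:
  "schur_majorant p q (x :: 'a::euclidean_space) \<in> borel_measurable borel"
  unfolding schur_majorant_def[abs_def] by measurable

lemma powr_comparable:
  fixes s t \<gamma> :: real
  assumes "0 < t" "t \<le> 4 * s" "s \<le> 4 * t"
  shows "s powr \<gamma> \<le> 4 powr \<bar>\<gamma>\<bar> * t powr \<gamma>"
proof -
  have "(s / t) powr \<gamma> \<le> 4 powr \<bar>\<gamma>\<bar>"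
  proof (cases "\<gamma> \<ge> 0")
    case True
    then show ?thesis using assms by (simp add: powr_mono2 field_simps)
  next
    case False
    have "(s / t) powr \<gamma> \<le> (1 / 4) powr \<gamma>"
      using False assms by (intro powr_mono2') (auto simp: field_simps)
    also have "\<dots> = 4 powr \<bar>\<gamma>\<bar>" using False by (simp add: powr_divide powr_minus_divide)
    finally show ?thesis .
  qed
  then show ?thesis using assms by (simp add: powr_divide field_simps)
qed

text \<open>Homogeneity dictates the power of |x|; only convergence is at stake. The near-diagonal
  part lives in a ball of radius 5 |x| about x, where |y| is comparable to |x|. The second part
  converges at infinity because d - 1 + p + \<gamma> > d, the third at the origin because \<gamma> -
  q < d.\<close>

lemma nn_integral_schur_majorant:
  fixes p q \<gamma> :: real
  assumes p: "p + \<gamma> > 1" and q: "\<gamma> < real DIM('a::euclidean_space) + q"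
  obtains M where "M \<ge> 0" "\<And>x::'a. x \<noteq> 0 \<Longrightarrow>
    (\<integral>\<^sup>+y. ennreal (schur_majorant p q x y * norm y powr (- \<gamma>)) \<partial>lborel) \<le> ennreal (M * norm x powr (1 - \<gamma>))"
proof -
  define d where "d = real DIM('a)"
  obtain C1 where C1: "C1 \<ge> 0" "\<And>R. R > 0 \<Longrightarrow>
    (\<integral>\<^sup>+z. indicator {z::'a. norm z \<le> R} z * ennreal (norm z powr (- (d - 1))) \<partial>lborel)
      \<le> ennreal (C1 * R powr (d - (d - 1)))"
    using nn_integral_norm_powr_inside[where 'a = 'a and s = "d - 1"] unfolding d_def by auto
  obtain C2 where C2: "C2 \<ge> 0" "\<And>R. R > 0 \<Longrightarrow>
    (\<integral>\<^sup>+z. indicator {z::'a. R \<le> norm z} z * ennreal (norm z powr (- (d - 1 + p + \<gamma>))) \<partial>lborel)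
      \<le> ennreal (C2 * R powr (d - (d - 1 + p + \<gamma>)))"
    using nn_integral_norm_powr_outside[where 'a = 'a and s = "d - 1 + p + \<gamma>"] p unfolding d_def by auto
  obtain C3 where C3: "C3 \<ge> 0" "\<And>R. R > 0 \<Longrightarrow>
    (\<integral>\<^sup>+z. indicator {z::'a. norm z \<le> R} z * ennreal (norm z powr (- (\<gamma> - q))) \<partial>lborel)
      \<le> ennreal (C3 * R powr (d - (\<gamma> - q)))"
    using nn_integral_norm_powr_inside[where 'a = 'a and s = "\<gamma> - q"] q unfolding d_def by auto
  define M1 where "M1 = 4 powr \<bar>- \<gamma>\<bar> * (C1 * 5)"
  define M2 where "M2 = C2 * (1 / 4) powr (1 - p - \<gamma>)"
  define M3 where "M3 = C3 * 4 powr (d + q - \<gamma>)"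
  have M: "M1 \<ge> 0" "M2 \<ge> 0" "M3 \<ge> 0" using C1 C2 C3 by (auto simp: M1_def M2_def M3_def)
  have "(\<integral>\<^sup>+y. ennreal (schur_majorant p q x y * norm y powr (- \<gamma>)) \<partial>lborel)
      \<le> ennreal ((M1 + M2 + M3) * norm x powr (1 - \<gamma>))" if x: "x \<noteq> 0" for x :: 'a
  proof -
    define X where "X = norm x"
    have X: "X > 0" using x by (simp add: X_def)
    define I1 where "I1 y = ennreal (4 powr \<bar>- \<gamma>\<bar> * X powr (- \<gamma>)) *
        (indicator {z::'a. norm z \<le> 5 * X} (x - y) * ennreal (norm (x - y) powr (- (d - 1))))" for y
    define I2 where "I2 y = ennreal (X powr p) * (indicator {z::'a. X / 4 \<le> norm z} y * ennreal (norm y powr (- (d - 1 + p + \<gamma>))))" for y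
    define I3 where "I3 y = ennreal (X powr (1 - d - q)) * (indicator {z::'a. norm z \<le> 4 * X} y * ennreal (norm y powr (- (\<gamma> - q))))" for y
    have [measurable]: "I1 \<in> borel_measurable borel" "I2 \<in> borel_measurable borel" "I3 \<in> borel_measurable borel"
      unfolding I1_def[abs_def] I2_def[abs_def] I3_def[abs_def] by measurable
    have "ennreal (schur_majorant p q x y * norm y powr (- \<gamma>)) \<le> I1 y + I2 y + I3 y" for y
    proof -
      define t1 where "t1 = (if X \<le> 4 * norm y \<and> norm y \<le> 4 * X then norm (x - y) powr (1 - d) else 0) * norm y powr (- \<gamma>)"
      define t2 where "t2 = (if X \<le> 4 * norm y then X powr p * norm y powr (1 - d - p) else 0) * norm y powr (- \<gamma>)"
      define t3 where "t3 = (if norm y \<le> 4 * X then X powr (1 - d - q) * norm y powr q else 0) * norm y powr (- \<gamma>)"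
      have t: "schur_majorant p q x y * norm y powr (- \<gamma>) = t1 + t2 + t3"
        unfolding schur_majorant_def t1_def t2_def t3_def X_def d_def by (simp only: distrib_right)
      have nn: "t1 \<ge> 0" "t2 \<ge> 0" "t3 \<ge> 0" by (auto simp: t1_def t2_def t3_def)
      have "ennreal t1 \<le> I1 y"
      proof (cases "X \<le> 4 * norm y \<and> norm y \<le> 4 * X")
        case True
        have "norm (x - y) \<le> 5 * X" using norm_triangle_ineq4[of x y] True by (simp add: X_def)
        moreover have "norm y powr (- \<gamma>) \<le> 4 powr \<bar>- \<gamma>\<bar> * X powr (- \<gamma>)"
          using True X by (intro powr_comparable) auto
        then have "t1 \<le> norm (x - y) powr (1 - d) * (4 powr \<bar>- \<gamma>\<bar> * X powr (- \<gamma>))"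
          using True by (simp add: t1_def mult_left_mono)
        ultimately show ?thesis
          by (simp add: I1_def ennreal_mult[symmetric] mult_ac ennreal_leI)
      qed (auto simp: t1_def)
      moreover have "ennreal t2 \<le> I2 y"
      proof (cases "X \<le> 4 * norm y")
        case True
        have e: "(1 - d - p) + (- \<gamma>) = - (d - 1 + p + \<gamma>)" by simp
        have "t2 = X powr p * norm y powr (- (d - 1 + p + \<gamma>))"
          using True unfolding t2_def e[symmetric] powr_add by simp
        then show ?thesis using True by (simp add: I2_def ennreal_mult[symmetric])
      qed (auto simp: t2_def)
      moreover have "ennreal t3 \<le> I3 y"
      proof (cases "norm y \<le> 4 * X")
        case True
        have e: "q + (- \<gamma>) = - (\<gamma> - q)" by simp
        have "t3 = X powr (1 - d - q) * norm y powr (- (\<gamma> - q))"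
          using True unfolding t3_def e[symmetric] powr_add by simp
        then show ?thesis using True by (simp add: I3_def ennreal_mult[symmetric])
      qed (auto simp: t3_def)
      ultimately show ?thesis unfolding t using nn by (simp add: add_mono)
    qed
    then have "(\<integral>\<^sup>+y. ennreal (schur_majorant p q x y * norm y powr (- \<gamma>)) \<partial>lborel)
        \<le> (\<integral>\<^sup>+y. I1 y + I2 y + I3 y \<partial>lborel)"
      by (intro nn_integral_mono)
    also have "\<dots> = (\<integral>\<^sup>+y. I1 y \<partial>lborel) + (\<integral>\<^sup>+y. I2 y \<partial>lborel) + (\<integral>\<^sup>+y. I3 y \<partial>lborel)"
      by (simp add: nn_integral_add)
    also have "\<dots> \<le> ennreal (M1 * X powr (1 - \<gamma>)) + ennreal (M2 * X powr (1 - \<gamma>)) + ennreal (M3 * X powr (1 - \<gamma>))"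
    proof (intro add_mono)
      have "(\<integral>\<^sup>+y. I1 y \<partial>lborel) = (\<integral>\<^sup>+z. I1 (x + (-1) *\<^sub>R z) \<partial>lborel)"
        by (subst nn_integral_lborel_affine[where c = "-1" and t = x]) auto
      also have "\<dots> = ennreal (4 powr \<bar>- \<gamma>\<bar> * X powr (- \<gamma>)) *
          (\<integral>\<^sup>+z. indicator {z::'a. norm z \<le> 5 * X} z * ennreal (norm z powr (- (d - 1))) \<partial>lborel)"
        unfolding I1_def by (subst nn_integral_cmult) auto
      also have "\<dots> \<le> ennreal (4 powr \<bar>- \<gamma>\<bar> * X powr (- \<gamma>)) * ennreal (C1 * (5 * X) powr (d - (d - 1)))"
        using X by (intro mult_left_mono C1(2)) auto
      also have "\<dots> = ennreal (M1 * (X * X powr (- \<gamma>)))"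
        using X C1(1) by (simp add: ennreal_mult[symmetric] M1_def mult_ac)
      also have "X * X powr (- \<gamma>) = X powr (1 - \<gamma>)"
        using X by (simp add: powr_diff powr_minus divide_inverse)
      finally show "(\<integral>\<^sup>+y. I1 y \<partial>lborel) \<le> ennreal (M1 * X powr (1 - \<gamma>))" .
    next
      have "(\<integral>\<^sup>+y. I2 y \<partial>lborel) = ennreal (X powr p) *
          (\<integral>\<^sup>+z. indicator {z::'a. X / 4 \<le> norm z} z * ennreal (norm z powr (- (d - 1 + p + \<gamma>))) \<partial>lborel)"
        unfolding I2_def by (subst nn_integral_cmult) auto
      also have "\<dots> \<le> ennreal (X powr p) * ennreal (C2 * (X / 4) powr (d - (d - 1 + p + \<gamma>)))"
        using X by (intro mult_left_mono C2(2)) auto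
      also have "\<dots> = ennreal (M2 * (X powr p * X powr (1 - p - \<gamma>)))"
        using X C2(1) by (simp add: ennreal_mult[symmetric] M2_def mult_ac powr_divide algebra_simps)
      also have "X powr p * X powr (1 - p - \<gamma>) = X powr (1 - \<gamma>)"
        by (simp add: powr_add[symmetric])
      finally show "(\<integral>\<^sup>+y. I2 y \<partial>lborel) \<le> ennreal (M2 * X powr (1 - \<gamma>))" .
    next
      have "(\<integral>\<^sup>+y. I3 y \<partial>lborel) = ennreal (X powr (1 - d - q)) *
          (\<integral>\<^sup>+z. indicator {z::'a. norm z \<le> 4 * X} z * ennreal (norm z powr (- (\<gamma> - q))) \<partial>lborel)"
        unfolding I3_def by (subst nn_integral_cmult) auto
      also have "\<dots> \<le> ennreal (X powr (1 - d - q)) * ennreal (C3 * (4 * X) powr (d - (\<gamma> - q)))"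
        using X by (intro mult_left_mono C3(2)) auto
      also have "\<dots> = ennreal (M3 * (X powr (1 - d - q) * X powr (d + q - \<gamma>)))"
        using X C3(1) by (simp add: ennreal_mult[symmetric] M3_def mult_ac powr_mult algebra_simps)
      also have "X powr (1 - d - q) * X powr (d + q - \<gamma>) = X powr (1 - \<gamma>)"
        by (simp add: powr_add[symmetric])
      finally show "(\<integral>\<^sup>+y. I3 y \<partial>lborel) \<le> ennreal (M3 * X powr (1 - \<gamma>))" .
    qed
    also have "\<dots> = ennreal ((M1 + M2 + M3) * X powr (1 - \<gamma>))"
      using M by (simp add: distrib_right)
    finally show ?thesis by (simp add: X_def)
  qed
  moreover have "M1 + M2 + M3 \<ge> 0" using M by simp
  ultimately show thesis using that by blast
qed

text \<open>Schur's test with the weights |y|^(-\<gamma>) in y and |x|^(-\<gamma>') in x.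
  Cauchy-Schwarz uses the first integral, Tonelli and the second integral finish.\<close>

lemma schur_test:
  fixes p q \<delta> :: real
  defines "\<sigma> \<equiv> - (\<delta> + real DIM('a::euclidean_space)) / 2"
  assumes p: "\<sigma> - 1 < p" and q: "2 - real DIM('a) - \<sigma> < q"
  obtains M where "M \<ge> 0" "\<And>u g :: 'a \<Rightarrow> real. u \<in> borel_measurable borel \<Longrightarrow> g \<in> borel_measurable borel \<Longrightarrow>
     (\<And>x. x \<noteq> 0 \<Longrightarrow> ennreal \<bar>u x\<bar> \<le> (\<integral>\<^sup>+y. ennreal (schur_majorant p q x y * \<bar>g y\<bar>) \<partial>lborel)) \<Longrightarrow>
     (\<And>y. g y \<noteq> 0 \<Longrightarrow> y \<noteq> 0) \<Longrightarrow>
     (\<integral>\<^sup>+x. ennreal ((u x) ^ 2 * norm x powr (\<delta> + 2)) \<partial>lborel)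
       \<le> ennreal M * (\<integral>\<^sup>+y. ennreal ((g y) ^ 2 * norm y powr (\<delta> + 4)) \<partial>lborel)"
proof -
  define d where "d = real DIM('a)"
  \<comment> \<open>Matching the weights r^(\<delta>+2) and r^(\<delta>+4) forces \<gamma> -
    \<gamma>' = \<delta> + 3. The remaining freedom is fixed by \<gamma> + \<gamma>' = d + 1, which
    makes the two convergence conditions on p coincide, and likewise the two on q.\<close>
  define \<gamma> where "\<gamma> = (\<delta> + 4 + d) / 2"
  define \<gamma>' where "\<gamma>' = (d - \<delta> - 2) / 2"
  obtain M1 where M1: "M1 \<ge> 0" "\<And>x::'a. x \<noteq> 0 \<Longrightarrow>
    (\<integral>\<^sup>+y. ennreal (schur_majorant p q x y * norm y powr (- \<gamma>)) \<partial>lborel) \<le> ennreal (M1 * norm x powr (1 - \<gamma>))"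
    using nn_integral_schur_majorant[where 'a = 'a and p = p and q = q and \<gamma> = \<gamma>] p q
    by (auto simp: \<sigma>_def \<gamma>_def d_def field_simps)
  obtain M2 where M2: "M2 \<ge> 0" "\<And>y::'a. y \<noteq> 0 \<Longrightarrow>
    (\<integral>\<^sup>+x. ennreal (schur_majorant q p y x * norm x powr (- \<gamma>')) \<partial>lborel) \<le> ennreal (M2 * norm y powr (1 - \<gamma>'))"
    using nn_integral_schur_majorant[where 'a = 'a and p = q and q = p and \<gamma> = \<gamma>'] p q
    by (auto simp: \<sigma>_def \<gamma>'_def d_def field_simps)
  have "(\<integral>\<^sup>+x. ennreal ((u x) ^ 2 * norm x powr (\<delta> + 2)) \<partial>lborel)
       \<le> ennreal (M1 * M2) * (\<integral>\<^sup>+y. ennreal ((g y) ^ 2 * norm y powr (\<delta> + 4)) \<partial>lborel)"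
    if [measurable]: "u \<in> borel_measurable borel" "g \<in> borel_measurable borel"
      and ug: "\<And>x. x \<noteq> 0 \<Longrightarrow> ennreal \<bar>u x\<bar> \<le> (\<integral>\<^sup>+y. ennreal (schur_majorant p q x y * \<bar>g y\<bar>) \<partial>lborel)"
      and g0: "\<And>y. g y \<noteq> 0 \<Longrightarrow> y \<noteq> 0"
    for u g :: "'a \<Rightarrow> real"
  proof -
    define K where "K x y = schur_majorant p q x y" for x y :: 'a
    have K0: "K x y \<ge> 0" for x y by (simp add: K_def schur_majorant_nonneg)
    have [measurable]: "case_prod K \<in> borel_measurable (borel \<Otimes>\<^sub>M borel)" "K x \<in> borel_measurable borel" for x
      unfolding K_def[abs_def] by measurable
    have pw: "(norm y powr (\<gamma> / 2))\<^sup>2 = norm y powr \<gamma>" and pw': "(norm y powr - (\<gamma> / 2))\<^sup>2 = norm y powr (- \<gamma>)" for y :: 'a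
      by (simp_all add: power2_eq_square powr_add[symmetric])
    define J where "J x = (\<integral>\<^sup>+y. ennreal (K x y * ((g y) ^ 2 * norm y powr \<gamma>)) \<partial>lborel)" for x
    have pt: "ennreal ((u x) ^ 2 * norm x powr (\<delta> + 2)) \<le> ennreal (M1 * norm x powr (- \<gamma>')) * J x" for x
    proof (cases "x = 0")
      case False
      have "ennreal ((u x) ^ 2) = (ennreal \<bar>u x\<bar>) ^ 2" by (simp add: ennreal_power)
      also have "\<dots> \<le> (\<integral>\<^sup>+y. ennreal (K x y * \<bar>g y\<bar>) \<partial>lborel) ^ 2"
        unfolding K_def by (intro power_mono ug False) auto
      \<comment> \<open>The kernel is split into square roots and the weight |y|^(\<gamma>/2) is
        inserted and removed. At y = 0 the two powers would not multiply to 1, since both are 0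
        there, hence the assumption on the zeros of g.\<close>
      also have "(\<integral>\<^sup>+y. ennreal (K x y * \<bar>g y\<bar>) \<partial>lborel)
          = (\<integral>\<^sup>+y. ennreal (sqrt (K x y) * norm y powr (- \<gamma> / 2)) * ennreal (sqrt (K x y) * (\<bar>g y\<bar> * norm y powr (\<gamma> / 2))) \<partial>lborel)"
      proof (rule nn_integral_cong)
        fix y :: 'a
        have "sqrt (K x y) * norm y powr (- \<gamma> / 2) * (sqrt (K x y) * (\<bar>g y\<bar> * norm y powr (\<gamma> / 2))) = K x y * \<bar>g y\<bar>"
        proof (cases "g y = 0")
          case False
          have "sqrt (K x y) * norm y powr (- \<gamma> / 2) * (sqrt (K x y) * (\<bar>g y\<bar> * norm y powr (\<gamma> / 2)))
            = (sqrt (K x y) * sqrt (K x y)) * \<bar>g y\<bar> * (norm y powr (- \<gamma> / 2) * norm y powr (\<gamma> / 2))"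
            by (simp only: mult_ac)
          also have "norm y powr (- \<gamma> / 2) * norm y powr (\<gamma> / 2) = 1"
            using g0[OF False] by (simp add: powr_add[symmetric])
          finally show ?thesis using K0 by simp
        qed simp
        then show "ennreal (K x y * \<bar>g y\<bar>) = ennreal (sqrt (K x y) * norm y powr (- \<gamma> / 2)) * ennreal (sqrt (K x y) * (\<bar>g y\<bar> * norm y powr (\<gamma> / 2)))"
          using K0 by (subst ennreal_mult[symmetric]) auto
      qed
      also have "(\<dots>) ^ 2 \<le> (\<integral>\<^sup>+y. (ennreal (sqrt (K x y) * norm y powr (- \<gamma> / 2))) ^ 2 \<partial>lborel)
          * (\<integral>\<^sup>+y. (ennreal (sqrt (K x y) * (\<bar>g y\<bar> * norm y powr (\<gamma> / 2)))) ^ 2 \<partial>lborel)"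
        by (rule Cauchy_Schwarz_nn_integral) measurable
      also have "(\<integral>\<^sup>+y. (ennreal (sqrt (K x y) * norm y powr (- \<gamma> / 2))) ^ 2 \<partial>lborel)
          = (\<integral>\<^sup>+y. ennreal (K x y * norm y powr (- \<gamma>)) \<partial>lborel)"
        using K0 by (intro nn_integral_cong)
          (simp add: ennreal_power power_mult_distrib pw pw')
      also have "(\<integral>\<^sup>+y. (ennreal (sqrt (K x y) * (\<bar>g y\<bar> * norm y powr (\<gamma> / 2)))) ^ 2 \<partial>lborel) = J x"
        unfolding J_def using K0 by (intro nn_integral_cong)
          (simp add: ennreal_power power_mult_distrib pw pw')
      also have "(\<integral>\<^sup>+y. ennreal (K x y * norm y powr (- \<gamma>)) \<partial>lborel) \<le> ennreal (M1 * norm x powr (1 - \<gamma>))"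
        unfolding K_def by (rule M1(2)[OF False])
      finally have "ennreal ((u x) ^ 2) \<le> ennreal (M1 * norm x powr (1 - \<gamma>)) * J x"
        by (simp add: mult_right_mono)
      then have "ennreal ((u x) ^ 2) * ennreal (norm x powr (\<delta> + 2)) \<le> ennreal (M1 * norm x powr (1 - \<gamma>)) * J x * ennreal (norm x powr (\<delta> + 2))"
        by (rule mult_right_mono) simp
      also have "\<dots> = (ennreal (M1 * norm x powr (1 - \<gamma>)) * ennreal (norm x powr (\<delta> + 2))) * J x" by (simp add: mult_ac)
      also have "ennreal (M1 * norm x powr (1 - \<gamma>)) * ennreal (norm x powr (\<delta> + 2)) = ennreal (M1 * (norm x powr (1 - \<gamma>) * norm x powr (\<delta> + 2)))"
        using M1(1) by (simp add: ennreal_mult[symmetric] mult_ac)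
      also have "norm x powr (1 - \<gamma>) * norm x powr (\<delta> + 2) = norm x powr (- \<gamma>')"
        unfolding powr_add[symmetric] by (rule arg_cong[of _ _ "(powr) (norm x)"]) (simp add: \<gamma>_def \<gamma>'_def field_simps)
      finally show ?thesis by (simp add: ennreal_mult)
    qed simp
    have "(\<integral>\<^sup>+x. ennreal ((u x) ^ 2 * norm x powr (\<delta> + 2)) \<partial>lborel)
        \<le> (\<integral>\<^sup>+x. ennreal (M1 * norm x powr (- \<gamma>')) * J x \<partial>lborel)"
      by (intro nn_integral_mono pt)
    also have "\<dots> = (\<integral>\<^sup>+x. (\<integral>\<^sup>+y. ennreal (M1 * norm x powr (- \<gamma>')) * ennreal (K x y * ((g y) ^ 2 * norm y powr \<gamma>)) \<partial>lborel) \<partial>lborel)"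
      unfolding J_def by (intro nn_integral_cong nn_integral_cmult[symmetric]) measurable
    \<comment> \<open>Tonelli; the inner integral over x is then the second Schur integral for the
      transposed majorant.\<close>
    also have "\<dots> = (\<integral>\<^sup>+y. (\<integral>\<^sup>+x. ennreal (M1 * norm x powr (- \<gamma>')) * ennreal (K x y * ((g y) ^ 2 * norm y powr \<gamma>)) \<partial>lborel) \<partial>lborel)"
      by (rule lborel_pair.Fubini'[symmetric]) measurable
    also have "\<dots> \<le> (\<integral>\<^sup>+y. ennreal (M1 * M2) * ennreal ((g y) ^ 2 * norm y powr (\<delta> + 4)) \<partial>lborel)"
    proof (rule nn_integral_mono)
      fix y :: 'a
      show "(\<integral>\<^sup>+x. ennreal (M1 * norm x powr (- \<gamma>')) * ennreal (K x y * ((g y) ^ 2 * norm y powr \<gamma>)) \<partial>lborel)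
          \<le> ennreal (M1 * M2) * ennreal ((g y) ^ 2 * norm y powr (\<delta> + 4))"
      proof (cases "g y = 0")
        case False
        have "(\<integral>\<^sup>+x. ennreal (M1 * norm x powr (- \<gamma>')) * ennreal (K x y * ((g y) ^ 2 * norm y powr \<gamma>)) \<partial>lborel)
           = (\<integral>\<^sup>+x. ennreal (M1 * ((g y) ^ 2 * norm y powr \<gamma>)) * ennreal (schur_majorant q p y x * norm x powr (- \<gamma>')) \<partial>lborel)"
          using M1(1) by (intro nn_integral_cong)
            (simp add: K_def schur_majorant_swap[of q p] ennreal_mult[symmetric] schur_majorant_nonneg mult_ac)
        also have "\<dots> = ennreal (M1 * ((g y) ^ 2 * norm y powr \<gamma>)) * (\<integral>\<^sup>+x. ennreal (schur_majorant q p y x * norm x powr (- \<gamma>')) \<partial>lborel)"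
          by (intro nn_integral_cmult) measurable
        also have "\<dots> \<le> ennreal (M1 * ((g y) ^ 2 * norm y powr \<gamma>)) * ennreal (M2 * norm y powr (1 - \<gamma>'))"
          by (intro mult_left_mono M2(2) g0 False) auto
        also have "\<dots> = ennreal (M1 * M2 * ((g y) ^ 2 * (norm y powr \<gamma> * norm y powr (1 - \<gamma>'))))"
          using M1(1) M2(1) by (simp add: ennreal_mult[symmetric] mult_ac)
        also have "norm y powr \<gamma> * norm y powr (1 - \<gamma>') = norm y powr (\<delta> + 4)"
          unfolding powr_add[symmetric] by (rule arg_cong[of _ _ "(powr) (norm y)"]) (simp add: \<gamma>_def \<gamma>'_def field_simps)
        finally show ?thesis using M1(1) M2(1) by (simp add: ennreal_mult)
      qed simp
    qed
    also have "\<dots> = ennreal (M1 * M2) * (\<integral>\<^sup>+y. ennreal ((g y) ^ 2 * norm y powr (\<delta> + 4)) \<partial>lborel)"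
      by (intro nn_integral_cmult) measurable
    finally show ?thesis .
  qed
  moreover have "M1 * M2 \<ge> 0" using M1 M2 by simp
  ultimately show thesis using that by blast
qed

section \<open>Hardy's inequality\<close>

lemma continuous_on_mult_norm_powr:
  fixes h :: "'a::euclidean_space \<Rightarrow> real"
  assumes "continuous_on UNIV h" "r > 0" "\<And>x. norm x < r \<Longrightarrow> h x = 0"
  shows "continuous_on UNIV (\<lambda>x. h x * norm x powr p)"
proof -
  have "continuous_on (ball 0 r \<union> (- {0})) (\<lambda>x. h x * norm x powr p)"
  proof (rule continuous_on_open_Un)
    have "continuous_on (ball 0 r) (\<lambda>x::'a. 0::real)" by simp
    then show "continuous_on (ball 0 r) (\<lambda>x. h x * norm x powr p)"
      by (rule continuous_on_eq) (use assms(3) in auto)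
    show "continuous_on (- {0}) (\<lambda>x. h x * norm x powr p)"
      by (intro continuous_intros continuous_on_subset[OF assms(1)]) auto
  qed auto
  moreover have "ball 0 r \<union> (- {0}) = (UNIV :: 'a set)" using assms(2) by auto
  ultimately show ?thesis by simp
qed

context annular_C2
begin

text \<open>The field f^2 r^\<delta> x has divergence (2 f D + (d + \<delta>) f^2) r^\<delta> with D
  = x . grad f, and its integral is zero. This controls the integral of f^2 r^\<delta> by that of f
  D r^\<delta>; completing a square absorbs half of the former.\<close>

lemma hardy_inequality:
  fixes \<delta> :: real
  assumes \<kappa>: "real DIM('a) + \<delta> \<noteq> 0"
  shows "(LINT x|lborel. (f x) ^ 2 * norm x powr \<delta>)
    \<le> 4 / (real DIM('a) + \<delta>) ^ 2 * (\<Sum>b\<in>Basis. LINT x|lborel. (f1 b x) ^ 2 * norm x powr (\<delta> + 2))"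
proof -
  define d where "d = real DIM('a)"
  define k where "k = d + \<delta>"
  have k: "k \<noteq> 0" using \<kappa> by (simp add: k_def d_def)
  have near: "f x = 0" "b \<in> Basis \<Longrightarrow> f1 b x = 0" if "norm x < r" for x b
    using that supp_f[of x] supp_f1[of b x] by force+
  have far: "f x = 0" "b \<in> Basis \<Longrightarrow> f1 b x = 0" if "norm x > R" for x b
    using that supp_f[of x] supp_f1[of b x] by force+
  \<comment> \<open>The derivative along b of the b-component of that field, so the sum over b is
    the divergence.\<close>
  define F' where "F' b x = (2 * f x * f1 b x * (x \<bullet> b) + (f x) ^ 2) * norm x powr \<delta>
      + (\<delta> * (f x) ^ 2 * (x \<bullet> b) ^ 2) * norm x powr (\<delta> - 2)" for b x
  have cF': "continuous_on UNIV (F' b)" if b: "b \<in> Basis" for b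
    unfolding F'_def[abs_def]
    by (intro continuous_on_add continuous_on_mult_norm_powr[OF _ r_pos])
       (auto intro!: continuous_intros cont_f cont_f1 b simp: near)
  have intF': "integrable lborel (F' b)" if b: "b \<in> Basis" for b
    by (rule integrable_continuous_bounded_support[OF cF'[OF b], of R]) (simp add: F'_def far)
  have zero: "(LINT x|lborel. F' b x) = 0" if b: "b \<in> Basis" for b
  proof (rule integral_line_derivative_eq_0[where F = "\<lambda>x. (f x) ^ 2 * (x \<bullet> b) * norm x powr \<delta>" and b = b and R = R])
    fix x
    show "((\<lambda>t. (f (x + t *\<^sub>R b)) ^ 2 * ((x + t *\<^sub>R b) \<bullet> b) * norm (x + t *\<^sub>R b) powr \<delta>)
         has_real_derivative F' b x) (at 0)"
    proof (cases "norm x < r")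
      case True
      have "\<forall>\<^sub>F t in nhds 0. x + t *\<^sub>R b \<in> ball 0 r"
      proof (rule topological_tendstoD)
        show "((\<lambda>t. x + t *\<^sub>R b) \<longlongrightarrow> x) (nhds 0)"
          using tendsto_add[OF tendsto_const[of x] tendsto_scaleR[OF filterlim_ident[of "nhds (0::real)"] tendsto_const[of b]]]
          by simp
      qed (use True in auto)
      then have "\<forall>\<^sub>F t in nhds 0. (f (x + t *\<^sub>R b)) ^ 2 * ((x + t *\<^sub>R b) \<bullet> b) * norm (x + t *\<^sub>R b) powr \<delta> = 0"
        by eventually_elim (simp add: near)
      then have "((\<lambda>t. (f (x + t *\<^sub>R b)) ^ 2 * ((x + t *\<^sub>R b) \<bullet> b) * norm (x + t *\<^sub>R b) powr \<delta>) has_real_derivative 0) (at 0)"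
        by (subst DERIV_cong_ev[where g = "\<lambda>_. 0"]) auto
      then show ?thesis using True by (simp add: F'_def near)
    next
      case False
      then have x: "x \<noteq> 0" using r_pos by auto
      \<comment> \<open>The case e = 0 of the regularised power, whose derivative formula is valid
        away from the origin.\<close>
      have np: "norm z powr s = (norm z ^ 2 + 0 ^ 2) powr (s / 2)" for z :: 'a and s
        by (cases "z = 0") (simp_all add: powr_powr flip: powr_numeral)
      have e: "\<delta> / 2 - 1 = (\<delta> - 2) / 2" by simp
      have 1: "((\<lambda>t. norm (x + t *\<^sub>R b) powr \<delta>) has_real_derivative \<delta> * (x \<bullet> b) * norm x powr (\<delta> - 2)) (at 0)"
        unfolding np
        by (rule DERIV_cong[OF norm_sq_plus_powr_line_derivative]) (use x in \<open>simp_all add: e\<close>)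
      have 2: "((\<lambda>t. (f (x + t *\<^sub>R b)) ^ 2) has_real_derivative 2 * f x * f1 b x) (at 0)"
        using DERIV_power[OF D1[OF b], of x 2] by (simp add: mult_ac)
      have bb: "b \<bullet> b = 1" using b by simp
      show ?thesis
        by (rule DERIV_cong[OF DERIV_mult[OF DERIV_mult[OF 2 inner_line_derivative] 1]])
           (simp add: F'_def bb algebra_simps power2_eq_square)
    qed
  next
    show "continuous_on UNIV (\<lambda>x. (f x) ^ 2 * (x \<bullet> b) * norm x powr \<delta>)"
      by (rule continuous_on_mult_norm_powr[OF _ r_pos]) (auto intro!: continuous_intros cont_f simp: near)
  qed (use cF' b far in auto)
  define A where "A x = (f x) ^ 2 * norm x powr \<delta>" for x
  define G where "G b x = (f1 b x) ^ 2 * norm x powr (\<delta> + 2)" for b x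
  have intA: "integrable lborel A"
    unfolding A_def[abs_def]
    by (rule integrable_continuous_bounded_support[where R = R], rule continuous_on_mult_norm_powr[OF _ r_pos])
       (auto intro!: continuous_intros cont_f simp: near far)
  have intG: "integrable lborel (G b)" if "b \<in> Basis" for b
    unfolding G_def[abs_def]
    by (rule integrable_continuous_bounded_support[where R = R], rule continuous_on_mult_norm_powr[OF _ r_pos])
       (use that in \<open>auto intro!: continuous_intros cont_f1 simp: near far\<close>)
  have sq: "(\<Sum>b\<in>Basis. (x \<bullet> b) ^ 2) = norm x ^ 2" for x :: 'a
    unfolding power2_norm_eq_inner by (simp add: euclidean_inner[of x x] power2_eq_square)
  have pt: "\<bar>k\<bar> * A x \<le> sgn k * (\<Sum>b\<in>Basis. F' b x) + \<bar>k\<bar> / 2 * A x + 2 / \<bar>k\<bar> * (\<Sum>b\<in>Basis. G b x)" for x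
  proof (cases "x = 0")
    case True
    then have "f x = 0" "\<And>b. b \<in> Basis \<Longrightarrow> f1 b x = 0" using near r_pos by auto
    then show ?thesis by (simp add: A_def F'_def G_def)
  next
    case False
    define w where "w = norm x powr \<delta>"
    define n where "n = norm x"
    have n: "n > 0" using False by (simp add: n_def)
    have w0: "w \<ge> 0" by (simp add: w_def)
    define D where "D = (\<Sum>b\<in>Basis. (x \<bullet> b) * f1 b x)"
    define S where "S = (\<Sum>b\<in>Basis. (f1 b x) ^ 2)"
    have CS: "D ^ 2 \<le> n ^ 2 * S"
      unfolding D_def S_def n_def sq[symmetric] by (rule Cauchy_Schwarz_ineq_sum)
    have w2: "n ^ 2 * norm x powr (\<delta> - 2) = w"
      using n by (simp add: w_def n_def powr_diff)
    have w3: "norm x powr (\<delta> + 2) = n ^ 2 * w"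
      using n by (simp add: w_def n_def powr_add mult.commute)
    have "(\<Sum>b\<in>Basis. F' b x) = (2 * f x * D + d * (f x) ^ 2) * w + \<delta> * (f x) ^ 2 * (\<Sum>b\<in>Basis. (x \<bullet> b) ^ 2) * norm x powr (\<delta> - 2)"
      unfolding F'_def D_def w_def d_def
      by (simp add: sum.distrib sum_distrib_left sum_distrib_right algebra_simps)
    also have "\<dots> = 2 * f x * D * w + k * (f x) ^ 2 * w"
      unfolding sq k_def using w2[unfolded n_def] by (simp add: algebra_simps)
    finally have SF: "(\<Sum>b\<in>Basis. F' b x) = 2 * f x * D * w + k * (f x) ^ 2 * w" .
    have SG: "(\<Sum>b\<in>Basis. G b x) = n ^ 2 * S * w"
      unfolding G_def S_def w3 by (simp add: sum_distrib_left sum_distrib_right mult_ac)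
    \<comment> \<open>This square, with D^2 bounded by n^2 S, is the pointwise inequality after
      multiplication by 2 w / |k|. The sign of k enters so that both signs of d + \<delta> are
      covered at once.\<close>
    have "0 \<le> (\<bar>k\<bar> / 2 * f x + sgn k * D) ^ 2" by simp
    also have "\<dots> = \<bar>k\<bar> ^ 2 / 4 * (f x) ^ 2 + \<bar>k\<bar> * sgn k * f x * D + D ^ 2"
      using k by (simp add: power2_eq_square algebra_simps sgn_if)
    finally have "0 \<le> (\<bar>k\<bar> ^ 2 / 4 * (f x) ^ 2 + \<bar>k\<bar> * sgn k * f x * D + n ^ 2 * S) * (2 / \<bar>k\<bar> * w)"
      using CS w0 by (intro mult_nonneg_nonneg) auto
    also have "\<dots> = \<bar>k\<bar> / 2 * (f x) ^ 2 * w + sgn k * 2 * f x * D * w + 2 / \<bar>k\<bar> * (n ^ 2 * S * w)"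
      using k by (simp add: field_simps power2_eq_square)
    finally have "0 \<le> \<bar>k\<bar> / 2 * (f x) ^ 2 * w + sgn k * 2 * f x * D * w + 2 / \<bar>k\<bar> * (n ^ 2 * S * w)" .
    moreover have "sgn k * (2 * f x * D * w + k * (f x) ^ 2 * w) = sgn k * 2 * f x * D * w + \<bar>k\<bar> * ((f x) ^ 2 * w)"
      by (simp add: algebra_simps abs_sgn)
    ultimately show ?thesis unfolding SF SG A_def w_def[symmetric] by (simp add: mult_ac)
  qed
  have "\<bar>k\<bar> * (LINT x|lborel. A x) = (LINT x|lborel. \<bar>k\<bar> * A x)" by simp
  also have "\<dots> \<le> (LINT x|lborel. sgn k * (\<Sum>b\<in>Basis. F' b x) + \<bar>k\<bar> / 2 * A x + 2 / \<bar>k\<bar> * (\<Sum>b\<in>Basis. G b x))"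
    by (intro integral_mono pt) (auto intro!: intA intF' intG Bochner_Integration.integrable_add integrable_mult_right Bochner_Integration.integrable_sum simp del: integrable_mult_right_iff)
  also have "\<dots> = sgn k * (\<Sum>b\<in>Basis. LINT x|lborel. F' b x) + \<bar>k\<bar> / 2 * (LINT x|lborel. A x) + 2 / \<bar>k\<bar> * (\<Sum>b\<in>Basis. LINT x|lborel. G b x)"
    using intA intF' intG by simp
  also have "\<dots> = \<bar>k\<bar> / 2 * (LINT x|lborel. A x) + 2 / \<bar>k\<bar> * (\<Sum>b\<in>Basis. LINT x|lborel. G b x)"
    by (simp add: zero)
  finally have "\<bar>k\<bar> / 2 * (LINT x|lborel. A x) \<le> 2 / \<bar>k\<bar> * (\<Sum>b\<in>Basis. LINT x|lborel. G b x)" by simp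
  then have "2 / \<bar>k\<bar> * (\<bar>k\<bar> / 2 * (LINT x|lborel. A x)) \<le> 2 / \<bar>k\<bar> * (2 / \<bar>k\<bar> * (\<Sum>b\<in>Basis. LINT x|lborel. G b x))"
    by (rule mult_left_mono) simp
  moreover have "2 / \<bar>k\<bar> * (\<bar>k\<bar> / 2 * (LINT x|lborel. A x)) = (LINT x|lborel. A x)" using k by simp
  moreover have "2 / \<bar>k\<bar> * (2 / \<bar>k\<bar> * c) = 4 / k ^ 2 * c" for c
    by (simp add: power2_eq_square)
  ultimately have "(LINT x|lborel. A x) \<le> 4 / k ^ 2 * (\<Sum>b\<in>Basis. LINT x|lborel. G b x)" by (simp only:)
  then show ?thesis unfolding A_def G_def k_def d_def .
qed

end

section \<open>Kernels with subtracted Taylor terms\<close>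

lemma newton_kernel_minus: "newton_kernel b (- z) = - newton_kernel b z"
  by (simp add: newton_kernel_def)

lemma newton_kernel_scaleR:
  fixes z :: "'a::euclidean_space"
  assumes "s > 0"
  shows "newton_kernel b (s *\<^sub>R z) = s powr (1 - real DIM('a)) * newton_kernel b z"
  using assms by (simp add: newton_kernel_def powr_mult powr_diff powr_minus divide_inverse)

text \<open>If \<open>h\<close> is not integrable, its Bochner integral is 0 by convention.\<close>

lemma ennreal_abs_integral_le:
  fixes h :: "'a \<Rightarrow> real"
  shows "ennreal \<bar>LINT y|M. h y\<bar> \<le> (\<integral>\<^sup>+y. ennreal \<bar>h y\<bar> \<partial>M)"
proof (cases "integrable M h")
  case True
  then show ?thesis using integral_norm_bound_ennreal[OF True] by simp
qed (simp add: not_integrable_integral_eq)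

text \<open>For comparable norms the diagonal summand suffices. Otherwise |y| < |x| / 4, so |x - y|
  is at least 3/4 |x|, which gives the constant.\<close>

lemma abs_newton_kernel_le_majorant:
  fixes x y b :: "'a::euclidean_space"
  assumes b: "norm b \<le> 1" and x: "x \<noteq> 0" and y: "y \<noteq> 0" and q: "q \<le> 0" and yx: "norm y \<le> 4 * norm x"
  shows "\<bar>newton_kernel b (x - y)\<bar> \<le> (3 / 4) powr (1 - real DIM('a)) * schur_majorant p q x y"
proof -
  define d where "d = real DIM('a)"
  have d: "d \<ge> 1" by (simp add: d_def DIM_positive Suc_leI)
  have C1: "(3 / 4) powr (1 - d) \<ge> 1"
  proof -
    have "(3 / 4) powr 0 \<le> (3 / 4) powr (1 - d)" using d by (intro powr_mono') auto
    then show ?thesis by simp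
  qed
  have K: "\<bar>newton_kernel b (x - y)\<bar> \<le> norm (x - y) powr (1 - d)"
    unfolding d_def by (rule abs_newton_kernel_le[OF b])
  show ?thesis
  proof (cases "norm x \<le> 4 * norm y")
    case True
    have "norm (x - y) powr (1 - d) \<le> schur_majorant p q x y"
      using True yx by (simp add: schur_majorant_def d_def)
    also have "\<dots> = 1 * schur_majorant p q x y" by simp
    also have "\<dots> \<le> (3 / 4) powr (1 - d) * schur_majorant p q x y"
      by (intro mult_right_mono C1 schur_majorant_nonneg)
    finally show ?thesis using K by (simp add: d_def)
  next
    case False
    have "3 / 4 * norm x \<le> norm (x - y)"
      using False norm_triangle_ineq2[of x y] by linarith
    then have "norm (x - y) powr (1 - d) \<le> (3 / 4 * norm x) powr (1 - d)"
      using x d by (intro powr_mono2') auto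
    also have "\<dots> = (3 / 4) powr (1 - d) * (norm x powr (1 - d) * 1)"
      by (subst powr_mult) auto
    \<comment> \<open>Since |y| is at most |x| and q is not positive, the inserted factor is at
      least 1.\<close>
    also have "\<dots> \<le> (3 / 4) powr (1 - d) * (norm x powr (1 - d) * (norm y / norm x) powr q)"
    proof (intro mult_left_mono)
      have "norm y \<le> norm x" using False norm_ge_zero[of y] by linarith
      then have "1 powr q \<le> (norm y / norm x) powr q"
        using q x y by (intro powr_mono2') (auto simp: field_simps)
      then show "1 \<le> (norm y / norm x) powr q" by simp
    qed auto
    also have "norm x powr (1 - d) * (norm y / norm x) powr q = norm x powr (1 - d - q) * norm y powr q"
      using x by (simp add: powr_divide powr_diff)
    also have "\<dots> \<le> schur_majorant p q x y"
      using yx by (simp add: schur_majorant_def d_def)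
    finally show ?thesis using K by (simp add: d_def mult_left_mono)
  qed
qed

text \<open>Where 4 |x| is at most |y|, the expansion at s = 1 gives exactly the summand with p = N.
  Elsewhere there is no cancellation to use: the kernel and each subtracted term are bounded
  separately. The term k = N - 1 is the worst and equals, up to constants, |x|^(N-1) |y|^(2-d-N),
  which is where q = 2 - d - N comes from.\<close>

lemma newton_remainder_le_majorant:
  fixes b :: "'a::euclidean_space"
  assumes b: "norm b \<le> 1" and N: "N \<ge> 1" and E: "newton_expansion b N D C"
  obtains B where "B \<ge> 0" "\<And>x y. x \<noteq> 0 \<Longrightarrow> y \<noteq> 0 \<Longrightarrow>
    \<bar>newton_kernel b (x - y) - (\<Sum>k<N. D k x y)\<bar>
      \<le> B * schur_majorant (real N) (2 - real DIM('a) - real N) x y"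
proof -
  define d where "d = real DIM('a)"
  have d: "d \<ge> 1" by (simp add: d_def DIM_positive Suc_leI)
  note C = newton_expansionD(1)[OF E] and Db = newton_expansionD(4)[OF E] and ex = newton_expansionD(5)[OF E]
  define q where "q = 2 - d - real N"
  have q: "q \<le> 0" using d N by (simp add: q_def)
  define B where "B = C + (3 / 4) powr (1 - d) + real N * (C * 4 ^ N)"
  have B0: "B \<ge> 0" using C by (simp add: B_def)
  have "\<bar>newton_kernel b (x - y) - (\<Sum>k<N. D k x y)\<bar> \<le> B * schur_majorant (real N) q x y"
    if x: "x \<noteq> 0" and y: "y \<noteq> 0" for x y
  proof -
    define S where "S = schur_majorant (real N) q x y"
    have S0: "S \<ge> 0" by (simp add: S_def schur_majorant_nonneg)
    show ?thesis
    proof (cases "4 * norm x \<le> norm y")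
      case True
      have "\<bar>newton_kernel b (x - y) - (\<Sum>k<N. D k x y)\<bar> \<le> C * norm y powr (1 - d) * (norm x / norm y) ^ N"
        using ex[OF x y, of 1] True by (simp add: d_def)
      also have "\<dots> = C * (norm x powr real N * norm y powr (1 - d - real N))"
        using x y by (simp add: powr_diff powr_realpow power_divide mult_ac)
      also have "\<dots> \<le> C * S"
      proof (rule mult_left_mono[OF _ C])
        have "norm x \<le> 4 * norm y" using True norm_ge_zero[of x] by linarith
        then show "norm x powr real N * norm y powr (1 - d - real N) \<le> S"
          by (simp add: S_def schur_majorant_def d_def)
      qed
      also have "\<dots> \<le> B * S" unfolding B_def using C S0 by (intro mult_right_mono) auto
      finally show ?thesis by (simp add: S_def)
    next
      case False
      then have yx: "norm y \<le> 4 * norm x" by simp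
      define \<rho> where "\<rho> = norm x / norm y"
      have \<rho>: "\<rho> > 0" "1 \<le> 4 * \<rho>" using x y yx by (auto simp: \<rho>_def field_simps)
      have Dk: "\<bar>D k x y\<bar> \<le> C * 4 ^ N * S" if k: "k < N" for k
      proof -
        \<comment> \<open>The ratio \<rho> may be below 1 but is at least 1/4, so raising the
          exponent from k to N - 1 costs at most a power of 4.\<close>
        have "\<rho> ^ k \<le> 4 ^ N * \<rho> ^ (N - 1)"
        proof -
          have "N - 1 = k + (N - 1 - k)" using k by simp
          then have e: "\<rho> ^ (N - 1) = \<rho> ^ k * \<rho> ^ (N - 1 - k)" by (metis power_add)
          have "1 \<le> (4 * \<rho>) ^ (N - 1 - k)" using \<rho> by (intro one_le_power) auto
          also have "\<dots> = 4 ^ (N - 1 - k) * \<rho> ^ (N - 1 - k)" by (rule power_mult_distrib)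
          also have "\<dots> \<le> 4 ^ N * \<rho> ^ (N - 1 - k)"
            using \<rho> by (intro mult_right_mono power_increasing) auto
          finally have "\<rho> ^ k * 1 \<le> \<rho> ^ k * (4 ^ N * \<rho> ^ (N - 1 - k))"
            using \<rho> by (intro mult_left_mono) auto
          then show ?thesis unfolding e by (simp add: mult_ac)
        qed
        then have "\<bar>D k x y\<bar> \<le> C * norm y powr (1 - d) * (4 ^ N * \<rho> ^ (N - 1))"
          using Db[OF k x y] C unfolding \<rho>_def[symmetric] d_def
          by (meson mult_left_mono order_trans mult_nonneg_nonneg powr_ge_zero)
        also have "\<dots> = C * 4 ^ N * (norm x powr (1 - d - q) * norm y powr q)"
        proof -
          have "norm x powr (1 - d - q) = norm x ^ (N - 1)"
            using x N by (simp add: q_def powr_realpow[symmetric] of_nat_diff)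
          moreover have "norm y powr (1 - d) * \<rho> ^ (N - 1) = norm x ^ (N - 1) * norm y powr q"
          proof -
            have "q = (1 - d) - real (N - 1)" using N by (simp add: q_def of_nat_diff)
            then have "norm y powr q = norm y powr ((1 - d) - real (N - 1))" by (simp only:)
            also have "\<dots> = norm y powr (1 - d) / norm y ^ (N - 1)"
              unfolding powr_diff using y by (simp add: powr_realpow)
            finally show ?thesis by (simp add: \<rho>_def power_divide)
          qed
          ultimately show ?thesis by (simp add: mult_ac)
        qed
        also have "\<dots> \<le> C * 4 ^ N * S"
        proof (rule mult_left_mono)
          show "norm x powr (1 - d - q) * norm y powr q \<le> S"
            using yx by (simp add: S_def schur_majorant_def d_def)
        qed (use C in simp)
        finally show ?thesis .
      qed
      have "\<bar>newton_kernel b (x - y) - (\<Sum>k<N. D k x y)\<bar> \<le> \<bar>newton_kernel b (x - y)\<bar> + (\<Sum>k<N. \<bar>D k x y\<bar>)"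
        using sum_abs[of "\<lambda>k. D k x y" "{..<N}"] by linarith
      also have "\<dots> \<le> (3 / 4) powr (1 - d) * S + (\<Sum>k<N. C * 4 ^ N * S)"
        unfolding S_def d_def
        by (intro add_mono sum_mono abs_newton_kernel_le_majorant b x y q yx Dk[unfolded S_def]) auto
      also have "\<dots> \<le> B * S" unfolding B_def using C S0 by (simp add: algebra_simps)
      finally show ?thesis by (simp add: S_def)
    qed
  qed
  then show thesis using that[OF B0] by (simp add: q_def d_def)
qed

section \<open>Orthogonality of the Taylor coefficients to the Laplacian\<close>

context annular_C2
begin

lemma integrable_bounded_times_lap:
  assumes [measurable]: "h \<in> borel_measurable borel"
    and hb: "\<And>y. r \<le> norm y \<Longrightarrow> norm y \<le> R \<Longrightarrow> \<bar>h y\<bar> \<le> B"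
  shows "integrable lborel (\<lambda>y. h y * lap y)"
proof -
  obtain L where L: "\<And>x. \<bar>lap x\<bar> \<le> L" "L \<ge> 0" using lap_bounded by blast
  show ?thesis
  proof (rule integrableI_bounded_set[where A = "cball 0 R" and B = "\<bar>B\<bar> * L"])
    show "AE y in lborel. y \<in> cball 0 R \<longrightarrow> norm (h y * lap y) \<le> \<bar>B\<bar> * L"
    proof (intro AE_I2 impI)
      fix y
      show "norm (h y * lap y) \<le> \<bar>B\<bar> * L"
        using hb[of y] supp_lap[of y] L
        by (cases "lap y = 0") (auto simp: abs_mult intro!: mult_mono)
    qed
    show "AE y in lborel. y \<notin> cball 0 R \<longrightarrow> h y * lap y = 0"
      using supp_lap by (intro AE_I2) auto
  qed (auto simp: emeasure_lborel_cball_finite[simplified])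
qed

lemma integrable_newton_kernel_times_lap:
  assumes b: "b \<in> Basis"
  shows "integrable lborel (\<lambda>y. newton_kernel b (x - y) * lap y)"
proof -
  obtain L where L: "\<And>x. \<bar>lap x\<bar> \<le> L" "L \<ge> 0" using lap_bounded by blast
  show ?thesis
  proof (rule Bochner_Integration.integrable_bound)
    show "integrable lborel (\<lambda>y. L * (indicator (cball 0 R) y * norm (x - y) powr (- (real DIM('a) - 1))))"
      by (intro integrable_mult_right integrable_norm_powr_cball) simp
    show "AE y in lborel. norm (newton_kernel b (x - y) * lap y)
        \<le> norm (L * (indicator (cball 0 R) y * norm (x - y) powr (- (real DIM('a) - 1))))"
    proof (rule AE_I2)
      fix y
      have "\<bar>newton_kernel b (x - y)\<bar> * \<bar>lap y\<bar> \<le> norm (x - y) powr (1 - real DIM('a)) * L"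
        using b by (intro mult_mono abs_newton_kernel_le L) auto
      then show "norm (newton_kernel b (x - y) * lap y)
          \<le> norm (L * (indicator (cball 0 R) y * norm (x - y) powr (- (real DIM('a) - 1))))"
        using supp_lap[of y] L by (cases "lap y = 0") (auto simp: abs_mult mult_ac)
    qed
  qed measurable
qed

text \<open>The common core of the arguments at the origin and at infinity. Integrating the
  expansion of \<open>H s\<close> against the Laplacian leaves a polynomial in s of size O(s^N),
  whose coefficients therefore vanish. In both applications H0 says that the gradient is zero at a
  rescaled point.\<close>

lemma taylor_coeff_orthogonal:
  fixes T :: "nat \<Rightarrow> 'a \<Rightarrow> real" and H :: "real \<Rightarrow> 'a \<Rightarrow> real"
  assumes [measurable]: "\<And>k. T k \<in> borel_measurable borel"
    and Tb: "\<And>k y. k < N \<Longrightarrow> r \<le> norm y \<Longrightarrow> norm y \<le> R \<Longrightarrow> \<bar>T k y\<bar> \<le> B k"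
    and \<epsilon>: "\<epsilon> > 0"
    and Hint: "\<And>s. 0 < s \<Longrightarrow> s \<le> \<epsilon> \<Longrightarrow> integrable lborel (\<lambda>y. H s y * lap y)"
    and H0: "\<And>s. 0 < s \<Longrightarrow> s \<le> \<epsilon> \<Longrightarrow> (LINT y|lborel. H s y * lap y) = 0"
    and HT: "\<And>s y. 0 < s \<Longrightarrow> s \<le> \<epsilon> \<Longrightarrow> r \<le> norm y \<Longrightarrow> norm y \<le> R \<Longrightarrow>
        \<bar>H s y - (\<Sum>k<N. T k y * s ^ k)\<bar> \<le> C * s ^ N"
    and C: "C \<ge> 0" and k: "k < N"
  shows "(LINT y|lborel. T k y * lap y) = 0"
proof -
  obtain L where L: "\<And>x. \<bar>lap x\<bar> \<le> L" "L \<ge> 0" using lap_bounded by blast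
  have Tint: "integrable lborel (\<lambda>y. T k y * lap y)" if "k < N" for k
    by (rule integrable_bounded_times_lap) (use Tb that in auto)
  define V where "V = measure lborel (cball (0::'a) R)"
  show ?thesis
  proof (rule partial_sum_coeffs_eq_0[OF \<epsilon> _ k, of "\<lambda>k. LINT y|lborel. T k y * lap y"])
    fix s :: real assume s: "0 < s" "s \<le> \<epsilon>"
    have Sint: "integrable lborel (\<lambda>y. \<Sum>k<N. s ^ k * (T k y * lap y))"
      by (intro Bochner_Integration.integrable_sum integrable_mult_right Tint) auto
    have "(\<Sum>k<N. (LINT y|lborel. T k y * lap y) * s ^ k) = (LINT y|lborel. (\<Sum>k<N. s ^ k * (T k y * lap y)))"
      using Tint by (subst Bochner_Integration.integral_sum) (auto simp: mult.commute)
    also have "\<dots> = (LINT y|lborel. (\<Sum>k<N. s ^ k * (T k y * lap y)) - H s y * lap y)"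
      using Sint Hint[OF s] H0[OF s] by simp
    finally have eq: "(\<Sum>k<N. (LINT y|lborel. T k y * lap y) * s ^ k)
        = (LINT y|lborel. (\<Sum>k<N. s ^ k * (T k y * lap y)) - H s y * lap y)" .
    have bd: "\<bar>(\<Sum>k<N. s ^ k * (T k y * lap y)) - H s y * lap y\<bar> \<le> (C * s ^ N * L) * indicator (cball 0 R) y" for y
    proof (cases "lap y = 0")
      case False
      have "(\<Sum>k<N. s ^ k * (T k y * lap y)) - H s y * lap y = - ((H s y - (\<Sum>k<N. T k y * s ^ k)) * lap y)"
      proof -
        have "(\<Sum>k<N. s ^ k * (T k y * lap y)) = (\<Sum>k<N. T k y * s ^ k) * lap y"
          unfolding sum_distrib_right by (simp add: mult_ac)
        then show ?thesis by (simp only:) (simp add: left_diff_distrib)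
      qed
      also have "\<bar>\<dots>\<bar> \<le> (C * s ^ N) * L"
        unfolding abs_minus_cancel abs_mult using HT[OF s, of y] supp_lap[OF False] L
        by (intro mult_mono) auto
      finally show ?thesis using supp_lap[OF False] by simp
    next
      case True
      then show ?thesis using C L s by simp
    qed
    have "\<bar>LINT y|lborel. (\<Sum>k<N. s ^ k * (T k y * lap y)) - H s y * lap y\<bar>
        \<le> (LINT y|lborel. \<bar>(\<Sum>k<N. s ^ k * (T k y * lap y)) - H s y * lap y\<bar>)"
      by (rule integral_abs_bound)
    also have "\<dots> \<le> (LINT y|lborel. (C * s ^ N * L) * indicator (cball (0::'a) R) y)"
      by (intro integral_mono bd) (auto intro!: Sint Hint s integrable_real_indicator simp: emeasure_lborel_cball_finite[simplified])
    also have "\<dots> = (C * L * V) * s ^ N" by (simp add: V_def)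
    finally show "\<bar>\<Sum>k<N. (LINT y|lborel. T k y * lap y) * s ^ k\<bar> \<le> (C * L * V) * s ^ N"
      unfolding eq .
  qed
qed

end

section \<open>The gradient estimate\<close>

context annular_C2
begin

text \<open>Near the origin the gradient vanishes, so its expansion in powers of \<open>x\<close> is trivial.\<close>

lemma inner_expansion_orthogonal:
  assumes b: "b \<in> Basis" and E: "newton_expansion b N D C"
    and x: "x \<noteq> 0" and k: "k < N"
  shows "integrable lborel (\<lambda>y. D k x y * lap y)" "(LINT y|lborel. D k x y * lap y) = 0"
proof -
  note C = newton_expansionD(1)[OF E] and Dm = newton_expansionD(2)[OF E]
    and Db = newton_expansionD(4)[OF E] and ex = newton_expansionD(5)[OF E]
  define d where "d = real DIM('a)"
  have d: "d \<ge> 1" by (simp add: d_def DIM_positive Suc_leI)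
  have bnd: "C * norm y powr (1 - d) * (t / norm y) ^ n \<le> C * r powr (1 - d) * (t / r) ^ n"
    if "r \<le> norm y" "t \<ge> 0" for y :: 'a and t n
  proof -
    have "norm y > 0" using that r_pos by linarith
    then show ?thesis using that r_pos C d
      by (intro mult_mono powr_mono2' power_mono divide_left_mono mult_nonneg_nonneg mult_pos_pos) auto
  qed
  have Db': "\<bar>D k x y\<bar> \<le> C * r powr (1 - d) * (norm x / r) ^ k"
    if "k < N" "r \<le> norm y" for k y
  proof -
    have "y \<noteq> 0" using that r_pos by auto
    then have "\<bar>D k x y\<bar> \<le> C * norm y powr (1 - d) * (norm x / norm y) ^ k"
      using Db that x by (simp add: d_def)
    also have "\<dots> \<le> C * r powr (1 - d) * (norm x / r) ^ k" using that by (intro bnd) auto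
    finally show ?thesis .
  qed
  show "integrable lborel (\<lambda>y. D k x y * lap y)"
    by (rule integrable_bounded_times_lap[OF Dm]) (use Db' k in blast)
  show "(LINT y|lborel. D k x y * lap y) = 0"
  \<comment> \<open>For s up to r / (4 |x|) the point s x lies in the hole of the annulus, and s |x|
    is at most |y| / 4 for every y of the annulus, so the expansion is valid there.\<close>
  proof (rule taylor_coeff_orthogonal[where H = "\<lambda>s y. newton_kernel b (s *\<^sub>R x - y)" and N = N
        and \<epsilon> = "r / (4 * norm x)" and C = "C * r powr (1 - d) * (norm x / r) ^ N"])
    show "\<bar>D k x y\<bar> \<le> C * r powr (1 - d) * (norm x / r) ^ k" if "k < N" "r \<le> norm y" for k y
      using Db' that .
    fix s :: real assume s: "0 < s" "s \<le> r / (4 * norm x)"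
    have sx: "s * norm x \<le> r / 4" using s x by (simp add: field_simps)
    show "integrable lborel (\<lambda>y. newton_kernel b (s *\<^sub>R x - y) * lap y)"
      by (rule integrable_newton_kernel_times_lap[OF b])
    have "norm (s *\<^sub>R x) < r" using sx s r_pos by simp
    then have "f1 b (s *\<^sub>R x) = 0" using supp_f1[OF b, of "s *\<^sub>R x"] by force
    then show "(LINT y|lborel. newton_kernel b (s *\<^sub>R x - y) * lap y) = 0"
      by (simp add: gradient_representation[OF b])
    fix y :: 'a assume y: "r \<le> norm y"
    then have "y \<noteq> 0" using r_pos by auto
    moreover have "s * norm x \<le> norm y / 4" using sx y by linarith
    ultimately have "\<bar>newton_kernel b (s *\<^sub>R x - y) - (\<Sum>k<N. D k x y * s ^ k)\<bar>
        \<le> C * norm y powr (1 - d) * (s * norm x / norm y) ^ N"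
      using ex[OF x, of y s] s by (simp add: d_def)
    also have "\<dots> \<le> C * r powr (1 - d) * (s * norm x / r) ^ N"
      using y s by (intro bnd) auto
    also have "\<dots> = C * r powr (1 - d) * (norm x / r) ^ N * s ^ N"
      by (simp add: power_mult_distrib power_divide)
    finally show "\<bar>newton_kernel b (s *\<^sub>R x - y) - (\<Sum>k<N. D k x y * s ^ k)\<bar>
        \<le> C * r powr (1 - d) * (norm x / r) ^ N * s ^ N" .
  qed (use C r_pos x k Dm in auto)
qed

text \<open>By homogeneity, the same argument at infinity, where the gradient vanishes as well.\<close>

lemma outer_expansion_orthogonal:
  assumes b: "b \<in> Basis" and E: "newton_expansion b N D C"
    and x: "x \<noteq> 0" and k: "k < N"
  shows "integrable lborel (\<lambda>y. D k y x * lap y)" "(LINT y|lborel. D k y x * lap y) = 0"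
proof -
  note C = newton_expansionD(1)[OF E] and Dm = newton_expansionD(3)[OF E]
    and Db = newton_expansionD(4)[OF E] and ex = newton_expansionD(5)[OF E]
  define d where "d = real DIM('a)"
  \<comment> \<open>A positive number above R; the locale leaves the sign of R open when f is
    zero.\<close>
  define Q where "Q = \<bar>R\<bar> + 1"
  have Q: "Q > 0" "R < Q" by (auto simp: Q_def)
  have bnd: "C * norm x powr (1 - d) * (t * norm y / norm x) ^ n \<le> C * norm x powr (1 - d) * (t * Q / norm x) ^ n"
    if "norm y \<le> R" "t \<ge> 0" for y :: 'a and t n
    using that Q C by (intro mult_mono power_mono divide_right_mono mult_left_mono) auto
  have Db': "\<bar>D k y x\<bar> \<le> C * norm x powr (1 - d) * (Q / norm x) ^ k"
    if "k < N" "r \<le> norm y" "norm y \<le> R" for k y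
  proof -
    have "y \<noteq> 0" using that r_pos by auto
    then have "\<bar>D k y x\<bar> \<le> C * norm x powr (1 - d) * (1 * norm y / norm x) ^ k"
      using Db that x by (simp add: d_def)
    also have "\<dots> \<le> C * norm x powr (1 - d) * (1 * Q / norm x) ^ k" using that by (intro bnd) auto
    finally show ?thesis by simp
  qed
  \<comment> \<open>Since s y - x = - s (x / s - y), oddness and homogeneity turn scaling of the
    integration variable into evaluation of the gradient at x / s.\<close>
  have comm: "newton_kernel b (s *\<^sub>R y - x) = - (s powr (1 - d)) * newton_kernel b ((1 / s) *\<^sub>R x - y)" if "s > 0" for s y
  proof -
    have "s *\<^sub>R y - x = - (s *\<^sub>R ((1 / s) *\<^sub>R x - y))" using that by (simp add: scaleR_diff_right)
    then show ?thesis using that by (simp only: newton_kernel_minus newton_kernel_scaleR d_def)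
  qed
  show "integrable lborel (\<lambda>y. D k y x * lap y)"
    by (rule integrable_bounded_times_lap[OF Dm]) (use Db' k in blast)
  show "(LINT y|lborel. D k y x * lap y) = 0"
  \<comment> \<open>For s up to |x| / (4 Q) the point x / s lies beyond the support, and s |y| is at
    most |x| / 4 on the annulus.\<close>
  proof (rule taylor_coeff_orthogonal[where T = "\<lambda>k y. D k y x" and H = "\<lambda>s y. newton_kernel b (s *\<^sub>R y - x)" and N = N
        and \<epsilon> = "norm x / (4 * Q)" and C = "C * norm x powr (1 - d) * (Q / norm x) ^ N"])
    show "\<bar>D k y x\<bar> \<le> C * norm x powr (1 - d) * (Q / norm x) ^ k"
      if "k < N" "r \<le> norm y" "norm y \<le> R" for k y
      using Db' that .
    fix s :: real assume s: "0 < s" "s \<le> norm x / (4 * Q)"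
    have sQ: "s * Q \<le> norm x / 4" using s Q by (simp add: field_simps)
    have eq: "newton_kernel b (s *\<^sub>R y - x) * lap y = - (s powr (1 - d)) * (newton_kernel b ((1 / s) *\<^sub>R x - y) * lap y)" for y
      by (simp add: comm[OF s(1)])
    show "integrable lborel (\<lambda>y. newton_kernel b (s *\<^sub>R y - x) * lap y)"
      unfolding eq by (rule integrable_mult_right[OF integrable_newton_kernel_times_lap[OF b]])
    have "norm ((1 / s) *\<^sub>R x) > R"
    proof -
      have "norm x > 0" using x by simp
      then have "s * Q < norm x" using sQ by linarith
      then have "Q < norm x / s" using s by (simp add: field_simps)
      then show ?thesis using s Q by simp
    qed
    then have "f1 b ((1 / s) *\<^sub>R x) = 0" using supp_f1[OF b, of "(1 / s) *\<^sub>R x"] by force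
    then show "(LINT y|lborel. newton_kernel b (s *\<^sub>R y - x) * lap y) = 0"
      unfolding eq integral_mult_right_zero gradient_representation[OF b] by simp
    fix y :: 'a assume y: "r \<le> norm y" "norm y \<le> R"
    then have "y \<noteq> 0" using r_pos by auto
    moreover have "s * norm y \<le> s * Q" using s y Q by (intro mult_left_mono) auto
    then have "s * norm y \<le> norm x / 4" using sQ by linarith
    ultimately have "\<bar>newton_kernel b (s *\<^sub>R y - x) - (\<Sum>k<N. D k y x * s ^ k)\<bar>
        \<le> C * norm x powr (1 - d) * (s * norm y / norm x) ^ N"
      using ex[of y x s] s x by (simp add: d_def)
    also have "\<dots> \<le> C * norm x powr (1 - d) * (s * Q / norm x) ^ N"
      using y s by (intro bnd) auto
    also have "\<dots> = C * norm x powr (1 - d) * (Q / norm x) ^ N * s ^ N"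
      by (simp add: power_mult_distrib power_divide)
    finally show "\<bar>newton_kernel b (s *\<^sub>R y - x) - (\<Sum>k<N. D k y x * s ^ k)\<bar>
        \<le> C * norm x powr (1 - d) * (Q / norm x) ^ N * s ^ N" .
  qed (use C Q x k Dm in auto)
qed

end

text \<open>The kernel K and its bound are fixed before f is chosen, and the representation is
  required of all annular functions; this makes M uniform. Schur's test is applied with g equal to B
  / c times the Laplacian.\<close>

lemma gradient_estimate_from_kernel:
  fixes p q \<delta> :: real and b :: "'a::euclidean_space" and K :: "'a \<Rightarrow> 'a \<Rightarrow> real"
  defines "\<sigma> \<equiv> - (\<delta> + real DIM('a)) / 2"
  assumes b: "b \<in> Basis" and p: "\<sigma> - 1 < p" and q: "2 - real DIM('a) - \<sigma> < q"
    and B: "B \<ge> 0" and KB: "\<And>x y. x \<noteq> 0 \<Longrightarrow> y \<noteq> 0 \<Longrightarrow> \<bar>K x y\<bar> \<le> B * schur_majorant p q x y"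
    and rep: "\<And>f f1 f2 r R x. annular_C2 f f1 f2 r R \<Longrightarrow> x \<noteq> 0 \<Longrightarrow>
      (LINT z|lborel. poisson_bump 1 (z::'a)) * f1 b x = (LINT y|lborel. K x y * annular_C2.lap f2 y)"
  obtains M where "M \<ge> 0" "\<And>f f1 f2 r R. annular_C2 f f1 f2 r R \<Longrightarrow>
    (\<integral>\<^sup>+x. ennreal ((f1 b x) ^ 2 * norm x powr (\<delta> + 2)) \<partial>lborel)
      \<le> ennreal M * (\<integral>\<^sup>+y. ennreal ((annular_C2.lap f2 y) ^ 2 * norm y powr (\<delta> + 4)) \<partial>lborel)"
proof -
  define c where "c = (LINT z|lborel. poisson_bump 1 (z::'a))"
  have c: "c > 0" unfolding c_def by (rule integral_poisson_bump_pos)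
  obtain M where M: "M \<ge> 0" and schur: "\<And>u g :: 'a \<Rightarrow> real. u \<in> borel_measurable borel \<Longrightarrow> g \<in> borel_measurable borel \<Longrightarrow>
     (\<And>x. x \<noteq> 0 \<Longrightarrow> ennreal \<bar>u x\<bar> \<le> (\<integral>\<^sup>+y. ennreal (schur_majorant p q x y * \<bar>g y\<bar>) \<partial>lborel)) \<Longrightarrow>
     (\<And>y. g y \<noteq> 0 \<Longrightarrow> y \<noteq> 0) \<Longrightarrow>
     (\<integral>\<^sup>+x. ennreal ((u x) ^ 2 * norm x powr (\<delta> + 2)) \<partial>lborel)
       \<le> ennreal M * (\<integral>\<^sup>+y. ennreal ((g y) ^ 2 * norm y powr (\<delta> + 4)) \<partial>lborel)"
    using schur_test[where 'a = 'a and p = p and q = q and \<delta> = \<delta>] p q unfolding \<sigma>_def by blast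
  have "(\<integral>\<^sup>+x. ennreal ((f1 b x) ^ 2 * norm x powr (\<delta> + 2)) \<partial>lborel)
      \<le> ennreal (M * (B / c) ^ 2) * (\<integral>\<^sup>+y. ennreal ((annular_C2.lap f2 y) ^ 2 * norm y powr (\<delta> + 4)) \<partial>lborel)"
    if "annular_C2 f f1 f2 r R" for f :: "'a \<Rightarrow> real" and f1 f2 r R
  proof -
    interpret annular_C2 f f1 f2 r R by fact
    have "(\<integral>\<^sup>+x. ennreal ((f1 b x) ^ 2 * norm x powr (\<delta> + 2)) \<partial>lborel)
        \<le> ennreal M * (\<integral>\<^sup>+y. ennreal ((B / c * lap y) ^ 2 * norm y powr (\<delta> + 4)) \<partial>lborel)"
    proof (rule schur)
      show "f1 b \<in> borel_measurable borel" using cont_f1[OF b] by (rule borel_measurable_continuous_onI)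
      show "(\<lambda>y. B / c * lap y) \<in> borel_measurable borel" by measurable
      show "y \<noteq> 0" if "B / c * lap y \<noteq> 0" for y
        using that supp_lap[of y] r_pos by auto
      fix x :: 'a assume x: "x \<noteq> 0"
      have "f1 b x = (LINT y|lborel. K x y * lap y) / c"
        using rep[OF that x] c by (simp add: c_def field_simps)
      then have eq: "f1 b x = (LINT y|lborel. K x y * lap y / c)" by simp
      have "ennreal \<bar>f1 b x\<bar> \<le> (\<integral>\<^sup>+y. ennreal \<bar>K x y * lap y / c\<bar> \<partial>lborel)"
        unfolding eq by (rule ennreal_abs_integral_le)
      also have "\<dots> \<le> (\<integral>\<^sup>+y. ennreal (schur_majorant p q x y * \<bar>B / c * lap y\<bar>) \<partial>lborel)"
      proof (intro nn_integral_mono ennreal_leI)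
        fix y
        show "\<bar>K x y * lap y / c\<bar> \<le> schur_majorant p q x y * \<bar>B / c * lap y\<bar>"
        proof (cases "lap y = 0")
          case False
          then have "y \<noteq> 0" using supp_lap[of y] r_pos by auto
          then have "\<bar>K x y\<bar> * (\<bar>lap y\<bar> / c) \<le> B * schur_majorant p q x y * (\<bar>lap y\<bar> / c)"
            using c by (intro mult_right_mono KB x) auto
          then show ?thesis using c B by (simp add: abs_mult mult_ac)
        qed simp
      qed
      finally show "ennreal \<bar>f1 b x\<bar> \<le> (\<integral>\<^sup>+y. ennreal (schur_majorant p q x y * \<bar>B / c * lap y\<bar>) \<partial>lborel)" .
    qed
    also have "(\<integral>\<^sup>+y. ennreal ((B / c * lap y) ^ 2 * norm y powr (\<delta> + 4)) \<partial>lborel)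
        = (\<integral>\<^sup>+y. ennreal ((B / c) ^ 2) * ennreal ((lap y) ^ 2 * norm y powr (\<delta> + 4)) \<partial>lborel)"
      by (intro nn_integral_cong) (simp add: ennreal_mult[symmetric] power_mult_distrib power_divide mult.assoc)
    also have "\<dots> = ennreal ((B / c) ^ 2) * (\<integral>\<^sup>+y. ennreal ((lap y) ^ 2 * norm y powr (\<delta> + 4)) \<partial>lborel)"
      by (rule nn_integral_cmult) measurable
    also have "ennreal M * \<dots> = ennreal (M * (B / c) ^ 2) * (\<integral>\<^sup>+y. ennreal ((lap y) ^ 2 * norm y powr (\<delta> + 4)) \<partial>lborel)"
      using M by (simp add: ennreal_mult mult.assoc)
    finally show ?thesis .
  qed
  moreover have "M * (B / c) ^ 2 \<ge> 0" using M by simp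
  ultimately show thesis using that by blast
qed

lemma gradient_estimate:
  fixes \<delta> :: real and b :: "'a::euclidean_space"
  assumes \<delta>: "\<delta> \<notin> \<int>" and b: "b \<in> Basis"
  obtains M where "M \<ge> 0" "\<And>f f1 f2 r R. annular_C2 f f1 f2 r R \<Longrightarrow>
    (\<integral>\<^sup>+x. ennreal ((f1 b x) ^ 2 * norm x powr (\<delta> + 2)) \<partial>lborel)
      \<le> ennreal M * (\<integral>\<^sup>+y. ennreal ((annular_C2.lap f2 y) ^ 2 * norm y powr (\<delta> + 4)) \<partial>lborel)"
proof -
  define d where "d = real DIM('a)"
  define \<sigma> where "\<sigma> = - (\<delta> + d) / 2"
  \<comment> \<open>Because \<delta> = - 2 \<sigma> - d.\<close>
  have \<sigma>: "\<sigma> \<notin> \<int>"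
  proof
    assume "\<sigma> \<in> \<int>"
    then have "- (2 * \<sigma>) - d \<in> \<int>" unfolding d_def by (intro Ints_diff Ints_minus Ints_mult) auto
    moreover have "- (2 * \<sigma>) - d = \<delta>" by (simp add: \<sigma>_def field_simps)
    ultimately show False using \<delta> by simp
  qed
  have nb: "norm b \<le> 1" using b by simp
  consider (inner) "\<sigma> > 1" | (mid) "2 - d < \<sigma>" "\<sigma> < 1" | (outer) "\<sigma> < 2 - d"
  proof -
    have "\<sigma> \<noteq> 1" using \<sigma> by auto
    moreover have "\<sigma> \<noteq> 2 - d" using \<sigma> unfolding d_def by auto
    ultimately show thesis using that by linarith
  qed
  then show thesis
  proof cases
    case mid
    \<comment> \<open>Here p = q = 0 lies in the Schur window, so the plain kernel works. Oddness
      and transposition reduce the case of large y to that of large x.\<close>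
    have bnd: "\<bar>newton_kernel b (x - y)\<bar> \<le> (3 / 4) powr (1 - d) * schur_majorant 0 0 x y" if "x \<noteq> 0" "y \<noteq> 0" for x y
    proof (cases "norm y \<le> 4 * norm x")
      case True
      then show ?thesis unfolding d_def using abs_newton_kernel_le_majorant[OF nb that, of 0] by simp
    next
      case False
      then have "norm x \<le> 4 * norm y" using norm_ge_zero[of x] by linarith
      then have "\<bar>newton_kernel b (y - x)\<bar> \<le> (3 / 4) powr (1 - d) * schur_majorant 0 0 y x"
        unfolding d_def using abs_newton_kernel_le_majorant[OF nb that(2,1), of 0] by simp
      then show ?thesis using newton_kernel_minus[of b "x - y"] schur_majorant_swap[of 0 0 x y] by simp
    qed
    show thesis
      by (rule gradient_estimate_from_kernel[OF b, where \<delta> = \<delta> and p = 0 and q = 0 and B = "(3 / 4) powr (1 - d)"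
            and K = "\<lambda>x y. newton_kernel b (x - y)"])
         (use mid that bnd in \<open>auto simp: annular_C2.gradient_representation[OF _ b] \<sigma>_def d_def\<close>)
  next
    case inner
    \<comment> \<open>The only integer in the open interval from \<sigma> - 1 to \<sigma>: the lower
      bound is the condition on p = N, the upper one that on q = 2 - d - N.\<close>
    define N where "N = nat \<lfloor>\<sigma>\<rfloor>"
    have "real N = of_int \<lfloor>\<sigma>\<rfloor>" using inner by (simp add: N_def)
    moreover have "of_int \<lfloor>\<sigma>\<rfloor> \<noteq> \<sigma>" using \<sigma> by (metis Ints_of_int)
    ultimately have N: "\<sigma> - 1 < real N" "real N < \<sigma>" by linarith+
    then have N1: "N \<ge> 1" using inner by linarith
    obtain D C where E: "newton_expansion b N D C"
      using newton_kernel_expansion[OF nb] by blast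
    obtain B where B: "B \<ge> 0" "\<And>x y. x \<noteq> 0 \<Longrightarrow> y \<noteq> 0 \<Longrightarrow>
      \<bar>newton_kernel b (x - y) - (\<Sum>k<N. D k x y)\<bar> \<le> B * schur_majorant (real N) (2 - real DIM('a) - real N) x y"
      using newton_remainder_le_majorant[OF nb N1 E] by blast
    show thesis
    proof (rule gradient_estimate_from_kernel[OF b, where \<delta> = \<delta> and p = "real N" and q = "2 - real DIM('a) - real N"
          and B = B and K = "\<lambda>x y. newton_kernel b (x - y) - (\<Sum>k<N. D k x y)"])
      fix f :: "'a \<Rightarrow> real" and f1 f2 r R and x :: 'a
      assume A: "annular_C2 f f1 f2 r R" and x: "x \<noteq> 0"
      interpret annular_C2 f f1 f2 r R by (rule A)
      note orth = inner_expansion_orthogonal[OF b E x]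
      have "(LINT y|lborel. (newton_kernel b (x - y) - (\<Sum>k<N. D k x y)) * lap y)
          = (LINT y|lborel. newton_kernel b (x - y) * lap y - (\<Sum>k<N. D k x y * lap y))"
        by (simp add: left_diff_distrib sum_distrib_right)
      also have "\<dots> = (LINT y|lborel. newton_kernel b (x - y) * lap y) - (\<Sum>k<N. LINT y|lborel. D k x y * lap y)"
      proof -
        have "integrable lborel (\<lambda>y. \<Sum>k<N. D k x y * lap y)"
          using orth(1) by (intro Bochner_Integration.integrable_sum) auto
        then show ?thesis using orth(1) integrable_newton_kernel_times_lap[OF b, of x]
          by (simp add: Bochner_Integration.integral_sum)
      qed
      also have "(\<Sum>k<N. LINT y|lborel. D k x y * lap y) = 0" using orth(2) by simp
      finally show "(LINT z|lborel. poisson_bump 1 (z::'a)) * f1 b x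
          = (LINT y|lborel. (newton_kernel b (x - y) - (\<Sum>k<N. D k x y)) * lap y)"
        by (simp add: gradient_representation[OF b])
    qed (use N B that in \<open>auto simp: \<sigma>_def d_def\<close>)
  next
    case outer
    \<comment> \<open>Now p and q exchange roles, and the same conditions become 2 - d - \<sigma> <
      N < 3 - d - \<sigma>.\<close>
    define N where "N = nat \<lfloor>3 - d - \<sigma>\<rfloor>"
    have "real N = of_int \<lfloor>3 - d - \<sigma>\<rfloor>" using outer by (simp add: N_def)
    moreover have "of_int \<lfloor>3 - d - \<sigma>\<rfloor> \<noteq> 3 - d - \<sigma>"
    proof
      assume "of_int \<lfloor>3 - d - \<sigma>\<rfloor> = 3 - d - \<sigma>"
      then have "\<sigma> = 3 - d - of_int \<lfloor>3 - d - \<sigma>\<rfloor>" by linarith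
      also have "\<dots> \<in> \<int>" unfolding d_def by (intro Ints_diff) auto
      finally show False using \<sigma> by simp
    qed
    ultimately have N: "2 - d - \<sigma> < real N" "real N < 3 - d - \<sigma>" by linarith+
    then have N1: "N \<ge> 1" using outer by linarith
    obtain D C where E: "newton_expansion b N D C"
      using newton_kernel_expansion[OF nb] by blast
    obtain B where B: "B \<ge> 0" "\<And>x y. x \<noteq> 0 \<Longrightarrow> y \<noteq> 0 \<Longrightarrow>
      \<bar>newton_kernel b (x - y) - (\<Sum>k<N. D k x y)\<bar> \<le> B * schur_majorant (real N) (2 - real DIM('a) - real N) x y"
      using newton_remainder_le_majorant[OF nb N1 E] by blast
    have N': "- (\<delta> + real DIM('a)) / 2 - 1 < 2 - real DIM('a) - real N"
      "2 - real DIM('a) - (- (\<delta> + real DIM('a)) / 2) < real N"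
      using N unfolding \<sigma>_def d_def by linarith+
    show thesis
    proof (rule gradient_estimate_from_kernel[OF b, where \<delta> = \<delta> and q = "real N" and p = "2 - real DIM('a) - real N"
          and B = B and K = "\<lambda>x y. newton_kernel b (x - y) + (\<Sum>k<N. D k y x)"])
      fix f :: "'a \<Rightarrow> real" and f1 f2 r R and x :: 'a
      assume A: "annular_C2 f f1 f2 r R" and x: "x \<noteq> 0"
      interpret annular_C2 f f1 f2 r R by (rule A)
      note orth = outer_expansion_orthogonal[OF b E x]
      have "(LINT y|lborel. (newton_kernel b (x - y) + (\<Sum>k<N. D k y x)) * lap y)
          = (LINT y|lborel. newton_kernel b (x - y) * lap y + (\<Sum>k<N. D k y x * lap y))"
        by (simp add: distrib_right sum_distrib_right)
      also have "\<dots> = (LINT y|lborel. newton_kernel b (x - y) * lap y) + (\<Sum>k<N. LINT y|lborel. D k y x * lap y)"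
      proof -
        have "integrable lborel (\<lambda>y. \<Sum>k<N. D k y x * lap y)"
          using orth(1) by (intro Bochner_Integration.integrable_sum) auto
        then show ?thesis using orth(1) integrable_newton_kernel_times_lap[OF b, of x]
          by (simp add: Bochner_Integration.integral_sum)
      qed
      also have "(\<Sum>k<N. LINT y|lborel. D k y x * lap y) = 0" using orth(2) by simp
      finally show "(LINT z|lborel. poisson_bump 1 (z::'a)) * f1 b x
          = (LINT y|lborel. (newton_kernel b (x - y) + (\<Sum>k<N. D k y x)) * lap y)"
        by (simp add: gradient_representation[OF b])
    next
      fix x y :: 'a assume xy: "x \<noteq> 0" "y \<noteq> 0"
      \<comment> \<open>The kernel is odd and the expansion is that of y - x, so the Taylor terms
        are added rather than subtracted.\<close>
      have "newton_kernel b (x - y) + (\<Sum>k<N. D k y x) = - (newton_kernel b (y - x) - (\<Sum>k<N. D k y x))"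
        using newton_kernel_minus[of b "x - y"] by simp
      then show "\<bar>newton_kernel b (x - y) + (\<Sum>k<N. D k y x)\<bar>
          \<le> B * schur_majorant (2 - real DIM('a) - real N) (real N) x y"
        using B(2)[OF xy(2,1)] by (simp only: abs_minus_cancel schur_majorant_swap[of _ "real N" x y])
    qed (use N' B(1) that in auto)
  qed
qed

section \<open>The weighted Rellich inequality\<close>

text \<open>Hardy's inequality followed by the gradient estimate in each basis direction. The latter
  is an inequality of extended nonnegative integrals; it becomes one of real integrals because both
  integrands are continuous with bounded support.\<close>

theorem weighted_rellich:
  fixes \<delta> :: real
  assumes \<delta>: "\<delta> \<notin> \<int>"
  obtains C where "\<And>(f :: 'a::euclidean_space \<Rightarrow> real) f1 f2 r R. annular_C2 f f1 f2 r R \<Longrightarrow>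
    (LINT x|lborel. (f x) ^ 2 * norm x powr \<delta>)
      \<le> C * (LINT x|lborel. (annular_C2.lap f2 x) ^ 2 * norm x powr (\<delta> + 4))"
proof -
  \<comment> \<open>The constant for each direction is chosen before the function, so the final C
    depends only on d and \<delta>.\<close>
  have "\<forall>b\<in>(Basis::'a set). \<exists>M\<ge>0. \<forall>(f :: 'a \<Rightarrow> real) f1 f2 r R. annular_C2 f f1 f2 r R \<longrightarrow>
    (\<integral>\<^sup>+x. ennreal ((f1 b x) ^ 2 * norm x powr (\<delta> + 2)) \<partial>lborel)
      \<le> ennreal M * (\<integral>\<^sup>+y. ennreal ((annular_C2.lap f2 y) ^ 2 * norm y powr (\<delta> + 4)) \<partial>lborel)"
    by (intro ballI, rule gradient_estimate[OF \<delta>]) blast+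
  from bchoice[OF this] obtain M where Mb: "\<forall>b\<in>(Basis::'a set). M b \<ge> 0 \<and>
    (\<forall>(f :: 'a \<Rightarrow> real) f1 f2 r R. annular_C2 f f1 f2 r R \<longrightarrow>
      (\<integral>\<^sup>+x. ennreal ((f1 b x) ^ 2 * norm x powr (\<delta> + 2)) \<partial>lborel)
        \<le> ennreal (M b) * (\<integral>\<^sup>+y. ennreal ((annular_C2.lap f2 y) ^ 2 * norm y powr (\<delta> + 4)) \<partial>lborel))" ..
  then have M0: "M b \<ge> 0" if "b \<in> Basis" for b :: 'a using that by blast
  \<comment> \<open>The quantity by which Hardy's inequality divides.\<close>
  have \<kappa>: "real DIM('a) + \<delta> \<noteq> 0"
  proof
    assume "real DIM('a) + \<delta> = 0"
    then have "\<delta> = - real DIM('a)" by simp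
    then show False using \<delta> by simp
  qed
  have "(LINT x|lborel. (f x) ^ 2 * norm x powr \<delta>)
      \<le> (4 / (real DIM('a) + \<delta>) ^ 2 * (\<Sum>b\<in>Basis. M b)) * (LINT x|lborel. (annular_C2.lap f2 x) ^ 2 * norm x powr (\<delta> + 4))"
    if A: "annular_C2 f f1 f2 r R" for f :: "'a \<Rightarrow> real" and f1 f2 r R
  proof -
    interpret annular_C2 f f1 f2 r R by fact
    define I where "I = (LINT y|lborel. (lap y) ^ 2 * norm y powr (\<delta> + 4))"
    have near: "lap x = 0" "b \<in> Basis \<Longrightarrow> f1 b x = 0" if "norm x < r" for x b
      using that supp_lap[of x] supp_f1[of b x] by force+
    have far: "lap x = 0" "b \<in> Basis \<Longrightarrow> f1 b x = 0" if "norm x > R" for x b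
      using that supp_lap[of x] supp_f1[of b x] by force+
    have intl: "integrable lborel (\<lambda>y. (lap y) ^ 2 * norm y powr (\<delta> + 4))"
      by (rule integrable_continuous_bounded_support[where R = R], rule continuous_on_mult_norm_powr[OF _ r_pos])
         (auto intro!: continuous_intros cont_lap simp: near far)
    have le: "(LINT x|lborel. (f1 b x) ^ 2 * norm x powr (\<delta> + 2)) \<le> M b * I" if b: "b \<in> Basis" for b
    proof -
      have int1: "integrable lborel (\<lambda>x. (f1 b x) ^ 2 * norm x powr (\<delta> + 2))"
        by (rule integrable_continuous_bounded_support[where R = R], rule continuous_on_mult_norm_powr[OF _ r_pos])
           (use b in \<open>auto intro!: continuous_intros cont_f1 simp: near far\<close>)
      have "(\<integral>\<^sup>+x. ennreal ((f1 b x) ^ 2 * norm x powr (\<delta> + 2)) \<partial>lborel)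
          \<le> ennreal (M b) * (\<integral>\<^sup>+y. ennreal ((lap y) ^ 2 * norm y powr (\<delta> + 4)) \<partial>lborel)"
        using Mb[rule_format, OF b] A by blast
      then have "ennreal (LINT x|lborel. (f1 b x) ^ 2 * norm x powr (\<delta> + 2)) \<le> ennreal (M b) * ennreal I"
        unfolding I_def
        by (simp add: nn_integral_eq_integral[OF int1] nn_integral_eq_integral[OF intl])
      also have "\<dots> = ennreal (M b * I)"
        using M0[OF b] by (simp add: ennreal_mult' I_def)
      finally show ?thesis
        using M0[OF b] by (subst (asm) ennreal_le_iff) (auto simp: I_def)
    qed
    have "(LINT x|lborel. (f x) ^ 2 * norm x powr \<delta>)
      \<le> 4 / (real DIM('a) + \<delta>) ^ 2 * (\<Sum>b\<in>Basis. LINT x|lborel. (f1 b x) ^ 2 * norm x powr (\<delta> + 2))"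
      by (rule hardy_inequality[OF \<kappa>])
    also have "\<dots> \<le> 4 / (real DIM('a) + \<delta>) ^ 2 * (\<Sum>b\<in>Basis. M b * I)"
      by (intro mult_left_mono sum_mono le) auto
    finally show ?thesis by (simp add: I_def sum_distrib_right mult.assoc)
  qed
  then show thesis by (rule that)
qed

section \<open>From iterated partial derivatives to the abstract setting\<close>

lemma smooth_fun_annular_C2:
  fixes f :: "real^'n::finite \<Rightarrow> real"
  assumes sm: "smooth_fun f" and a: "0 < a" and supp: "\<And>x. f x \<noteq> 0 \<Longrightarrow> a \<le> norm x \<and> norm x \<le> b"
  obtains f1 f2 where "annular_C2 f f1 f2 a b" "annular_C2.lap f2 = laplacian f"
proof -
  define f1 where "f1 v x = deriv (\<lambda>t. f (x + t *\<^sub>R v)) 0" for v x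
  define f2 where "f2 v x = deriv (\<lambda>t. f1 v (x + t *\<^sub>R v)) 0" for v x
  have f1: "f1 (axis i 1) = partial_deriv i f" for i
    by (simp add: f1_def[abs_def] partial_deriv_def)
  have f2: "f2 (axis i 1) = partial_deriv i (partial_deriv i f)" for i
    unfolding f2_def[abs_def] f1 by (simp add: partial_deriv_def)
  have Basis_eq: "(Basis :: (real^'n) set) = range (\<lambda>i. axis i 1)"
    by (auto simp: Basis_vec_def)
  have cont: "continuous_on UNIV (iter_partial is f)"
    and diff: "(\<lambda>t. iter_partial is f (x + t *\<^sub>R axis i 1)) differentiable (at 0)" for "is" i x
    using sm by (auto simp: smooth_fun_def)
  have D: "((\<lambda>t. iter_partial is f (x + t *\<^sub>R axis i 1)) has_real_derivative iter_partial (i # is) f x) (at 0)" for "is" i x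
    using diff[of "is" x i] by (simp add: partial_deriv_def DERIV_deriv_iff_real_differentiable)
  have "annular_C2 f f1 f2 a b"
  proof
    fix v :: "real^'n" and x assume "v \<in> Basis"
    then obtain i where v: "v = axis i 1" by (auto simp: Basis_eq)
    show "((\<lambda>t. f (x + t *\<^sub>R v)) has_real_derivative f1 v x) (at 0)"
      "((\<lambda>t. f1 v (x + t *\<^sub>R v)) has_real_derivative f2 v x) (at 0)"
      using D[of "[]" x i] D[of "[i]" x i] by (simp_all add: v f1 f2)
    show "continuous_on UNIV (f1 v)" "continuous_on UNIV (f2 v)"
      using cont[of "[i]"] cont[of "[i, i]"] by (simp_all add: v f1 f2)
  qed (use cont[of "[]"] a supp in auto)
  moreover have "annular_C2.lap f2 = laplacian f"
  proof
    fix x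
    \<comment> \<open>Distinct coordinates give distinct basis vectors, so summing over
      \<open>Basis\<close> is summing over coordinates.\<close>
    have "inj (\<lambda>i::'n. axis i (1::real))" by (auto simp: inj_on_def axis_eq_axis)
    then show "annular_C2.lap f2 x = laplacian f x"
      unfolding annular_C2.lap_def[OF \<open>annular_C2 f f1 f2 a b\<close>] laplacian_def Basis_eq
      by (simp add: sum.reindex f2)
  qed
  ultimately show thesis by (rule that)
qed

theorem mainTheorem11:
  fixes \<delta> :: real
  assumes "\<delta> \<notin> \<int>"
  shows "\<exists>C::real. \<forall>(f :: real^'n::finite \<Rightarrow> real) (a::real) b.
           smooth_fun f \<longrightarrow> 0 < a \<longrightarrow> a < b \<longrightarrow>
           (\<forall>x. f x \<noteq> 0 \<longrightarrow> a \<le> norm x \<and> norm x \<le> b) \<longrightarrow>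
           (LINT x|lborel. (f x)\<^sup>2 * norm x powr \<delta>)
             \<le> C * (LINT x|lborel. (laplacian f x)\<^sup>2 * norm x powr (\<delta> + 4))"
proof -
  obtain C where C: "\<And>(f :: real^'n \<Rightarrow> real) f1 f2 r R. annular_C2 f f1 f2 r R \<Longrightarrow>
    (LINT x|lborel. (f x)\<^sup>2 * norm x powr \<delta>)
      \<le> C * (LINT x|lborel. (annular_C2.lap f2 x)\<^sup>2 * norm x powr (\<delta> + 4))"
    using weighted_rellich[OF assms] by blast
  show ?thesis
  proof (intro exI[of _ C] allI impI)
    fix f :: "real^'n \<Rightarrow> real" and a b :: real
    assume "smooth_fun f" "0 < a" "\<forall>x. f x \<noteq> 0 \<longrightarrow> a \<le> norm x \<and> norm x \<le> b"
    then obtain f1 f2 where A: "annular_C2 f f1 f2 a b" and eq: "annular_C2.lap f2 = laplacian f"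
      using smooth_fun_annular_C2[of f a b] by blast
    show "(LINT x|lborel. (f x)\<^sup>2 * norm x powr \<delta>)
        \<le> C * (LINT x|lborel. (laplacian f x)\<^sup>2 * norm x powr (\<delta> + 4))"
      using C[OF A] unfolding eq .
  qed
qed

end
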